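(* Let $\mathbf{M}=(M_1,\dots,M_n)$ be a POVM on $\mathbb{C}^d$ with $M_i=\alpha_i\ket{\psi_i}\bra{\psi_i}$, unit vectors $\ket{\psi_i}$ and $0<\tilde\epsilon\le\alpha_i\le\epsilon$ for all $i$. Fix an integer $r\ge1$ and let $C=r\epsilon$. Then there exists a partition $\mathcal{S}=\{S_\beta\}_{\beta=1}^r$ of $[n]$ into disjoint subsets such that $$q(\mathbf{M},\mathcal{S})\ge\frac{1}{(1+\sqrt C)^2}\quad\text{and}\quad |S_\beta|\le d\,\frac{\epsilon}{\tilde\epsilon}\left(1+\frac{1}{\sqrt C}\right)^2\ \text{ for all }\beta.$$
   Context: A POVM on $\mathbb{C}^d$ is a tuple of positive semidefinite operators summing to $\mathbb{I}_d$. For a partition $\mathcal{S}=\{S_\beta\}$ of $[n]$, $q(\mathbf{M},\mathcal{S})=\left(\sum_\beta\left\|\sum_{i\in S_\beta}M_i\right\|\right)^{-1}$, where $\|\cdot\|$ is the operator norm (empty sums contribute $0$). *)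

theory Defs
  imports "HOL-Analysis.Analysis"
begin

definition cinner_vec :: "complex^'d \<Rightarrow> complex^'d \<Rightarrow> complex" where
  "cinner_vec x y = (\<Sum>j\<in>UNIV. cnj (x $ j) * y $ j)"

definition psd :: "complex^'d^'d \<Rightarrow> bool" where
  "psd A \<longleftrightarrow> (\<forall>x. Im (cinner_vec x (A *v x)) = 0 \<and> Re (cinner_vec x (A *v x)) \<ge> 0)"

definition op_norm :: "complex^'d^'d \<Rightarrow> real" where
  "op_norm A = onorm (\<lambda>x. A *v x)"

definition is_POVM :: "(nat \<Rightarrow> complex^'d^'d) \<Rightarrow> nat \<Rightarrow> bool" where
  "is_POVM M n \<longleftrightarrow> (\<forall>i<n. psd (M i)) \<and> (\<Sum>i<n. M i) = mat 1"

definition ketbra :: "complex^'d \<Rightarrow> complex^'d^'d" where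
  "ketbra \<psi> = (\<chi> j k. \<psi> $ j * cnj (\<psi> $ k))"

text \<open>Partition of [n] into r (possibly empty) blocks S 0, ..., S (r-1).\<close>
definition is_partition :: "(nat \<Rightarrow> nat set) \<Rightarrow> nat \<Rightarrow> nat \<Rightarrow> bool" where
  "is_partition S r n \<longleftrightarrow>
     (\<Union>\<beta><r. S \<beta>) = {..<n} \<and> (\<forall>\<beta><r. \<forall>\<gamma><r. \<beta> \<noteq> \<gamma> \<longrightarrow> S \<beta> \<inter> S \<gamma> = {})"

definition q_val :: "(nat \<Rightarrow> complex^'d^'d) \<Rightarrow> (nat \<Rightarrow> nat set) \<Rightarrow> nat \<Rightarrow> real" where
  "q_val M S r = inverse (\<Sum>\<beta><r. op_norm (\<Sum>i\<in>S \<beta>. M i))"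

end

theory Submission
  imports Defs "HOL-Complex_Analysis.Cauchy_Integral_Formula"
    "HOL-Computational_Algebra.Fundamental_Theorem_Algebra"
begin

text \<open>
  This is the Kadison-Singer argument of Marcus, Spielman and Srivastava. Give every pair \<open>(i, j)\<close>
  of an index and a block a variable and let \<open>G(z) = \<Prod>\<^sub>j det (\<Sum>\<^sub>i z(i, j) M\<^sub>i)\<close>. Since the \<open>M\<^sub>i\<close> have rank one,
  \<open>G\<close> is affine in each variable, so for an assignment \<open>f\<close> of indices to blocks the product of the
  characteristic polynomials \<open>\<Prod>\<^sub>j det (x - r \<Sum>\<^bsub>f i = j\<^esub> M\<^sub>i)\<close> is \<open>\<Prod>\<^sub>i (1 - r \<partial>\<^bsub>i, f i\<^esub>) G\<close> on the
  diagonal, and its average over \<open>f\<close> is \<open>\<Prod>\<^sub>i (1 - \<Sum>\<^sub>j \<partial>\<^bsub>i, j\<^esub>) G\<close>.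

  All polynomials involved are stable. Therefore the barriers \<open>D\<^sub>u p / p\<close> are nonincreasing and convex
  above the roots of \<open>p\<close>, and passing from \<open>p\<close> to \<open>(1 - D\<^sub>v) p\<close> while moving by \<open>\<delta> v\<close> does not
  increase any barrier provided \<open>D\<^sub>v p / p \<le> 1 - 1/\<delta>\<close>. Starting at \<open>C + \<surd>C\<close> with \<open>\<delta> = 1 + \<surd>C\<close> shows that
  the averaged polynomial has no zero above \<open>(1 + \<surd>C)\<^sup>2\<close>. Barriers are linear in the direction, so
  the averages can be replaced one index after the other by a single choice \<open>f i\<close> whose barrier
  stays below \<open>1\<close>. The resulting bound on the eigenvalues of each block gives the bound on
  \<open>q\<close>, and through the trace the bound on the block sizes.
\<close>

section \<open>Multiaffine polynomials\<close>

text \<open>The coefficients are real and independent of the field, so one family \<open>c\<close>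
  can be evaluated at real points (for barriers) and at complex points (for stability).\<close>

definition mlin :: "'k set \<Rightarrow> ('k set \<Rightarrow> real) \<Rightarrow> ('k \<Rightarrow> 'a::real_normed_field) \<Rightarrow> 'a" where
  "mlin V c z = (\<Sum>S\<in>Pow V. of_real (c S) * (\<Prod>k\<in>S. z k))"

text \<open>In \<open>pd\<close>, \<open>dd\<close> and \<open>one_minus_dd\<close> differential operators act on coefficient families.\<close>

definition pd :: "'k \<Rightarrow> ('k set \<Rightarrow> real) \<Rightarrow> 'k set \<Rightarrow> real" where
  "pd k c S = (if k \<in> S then 0 else c (insert k S))"

definition dd :: "'k set \<Rightarrow> ('k \<Rightarrow> real) \<Rightarrow> ('k set \<Rightarrow> real) \<Rightarrow> 'k set \<Rightarrow> real" where
  "dd V u c S = (\<Sum>k\<in>V. u k * pd k c S)"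

definition one_minus_dd :: "'k set \<Rightarrow> ('k \<Rightarrow> real) \<Rightarrow> ('k set \<Rightarrow> real) \<Rightarrow> 'k set \<Rightarrow> real" where
  "one_minus_dd V u c S = c S - dd V u c S"

lemma mlin_cong: "(\<And>k. k \<in> V \<Longrightarrow> z k = z' k) \<Longrightarrow> mlin V c z = mlin V c z'"
  unfolding mlin_def by (intro sum.cong refl arg_cong2[where f = "(*)"] prod.cong) auto

lemma mlin_of_real:
  "mlin V c (\<lambda>k. of_real (x k) :: 'a::real_normed_field) = of_real (mlin V c x)"
  by (simp add: mlin_def)

lemma mlin_cnj: "mlin V c (\<lambda>k. cnj (z k)) = cnj (mlin V c z)"
  by (simp add: mlin_def)

lemma mlin_sum:
  "mlin V (\<lambda>S. \<Sum>i\<in>I. a i * c i S) z = (\<Sum>i\<in>I. of_real (a i) * mlin V (c i) z)"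
  unfolding mlin_def
  by (simp add: sum_distrib_left sum_distrib_right mult.assoc) (rule sum.swap)

lemma mlin_dd: "mlin V (dd V u c) z = (\<Sum>k\<in>V. of_real (u k) * mlin V (pd k c) z)"
  using mlin_sum[of V u "\<lambda>k. pd k c" V z] by (simp add: dd_def[abs_def])

lemma mlin_one_minus_dd: "mlin V (one_minus_dd V u c) z = mlin V c z - mlin V (dd V u c) z"
  by (simp add: mlin_def one_minus_dd_def left_diff_distrib sum_subtractf)

lemma pd_commute: "pd k (pd l c) = pd l (pd k c)"
  by (rule ext) (auto simp: pd_def insert_commute)

lemma pd_sum: "pd k (\<lambda>S. \<Sum>i\<in>I. a i * c i S) = (\<lambda>S. \<Sum>i\<in>I. a i * pd k (c i) S)"
  by (rule ext) (simp add: pd_def)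

lemma dd_commute: "dd V u (dd V w c) = dd V w (dd V u c)"
proof
  fix S
  have "dd V u (dd V w c) S = (\<Sum>k\<in>V. u k * (\<Sum>l\<in>V. w l * pd k (pd l c) S))"
    by (simp add: dd_def[abs_def] pd_sum)
  also have "\<dots> = (\<Sum>l\<in>V. w l * (\<Sum>k\<in>V. u k * pd l (pd k c) S))"
    unfolding sum_distrib_left by (subst sum.swap) (simp add: pd_commute mult.left_commute)
  also have "\<dots> = dd V w (dd V u c) S"
    by (simp add: dd_def[abs_def] pd_sum)
  finally show "dd V u (dd V w c) S = dd V w (dd V u c) S" .
qed

lemma dd_diff: "dd V u (\<lambda>S. c S - c' S) = (\<lambda>S. dd V u c S - dd V u c' S)"
  by (rule ext) (simp add: dd_def pd_def sum_subtractf[symmetric] right_diff_distrib if_distrib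
      cong: if_cong)

lemma dd_one_minus_dd: "dd V u (one_minus_dd V w c) = one_minus_dd V w (dd V u c)"
  by (simp add: one_minus_dd_def[abs_def] dd_diff dd_commute)

lemma one_minus_dd_commute:
  "one_minus_dd V u (one_minus_dd V w c) = one_minus_dd V w (one_minus_dd V u c)"
  by (rule ext) (simp add: one_minus_dd_def[abs_def] dd_diff dd_commute)

lemma mlin_insert:
  assumes "finite V" "k \<notin> V"
  shows "mlin (insert k V) c z = mlin V c z + z k * mlin V (\<lambda>S. c (insert k S)) z"
proof -
  have inj: "inj_on (insert k) (Pow V)"
    using assms(2) by (auto simp: inj_on_def)
  have "mlin (insert k V) c z = mlin V c z
      + (\<Sum>S\<in>insert k ` Pow V. of_real (c S) * (\<Prod>k\<in>S. z k))"
    unfolding mlin_def Pow_insert using assms by (intro sum.union_disjoint) auto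
  also have "(\<Sum>S\<in>insert k ` Pow V. of_real (c S) * (\<Prod>k\<in>S. z k))
      = (\<Sum>S\<in>Pow V. z k * (of_real (c (insert k S)) * (\<Prod>k\<in>S. z k)))"
    unfolding sum.reindex[OF inj] comp_def
  proof (rule sum.cong[OF refl])
    fix S assume "S \<in> Pow V"
    then have "finite S" "k \<notin> S" using assms finite_subset by auto
    then show "of_real (c (insert k S)) * (\<Prod>k\<in>insert k S. z k)
        = z k * (of_real (c (insert k S)) * (\<Prod>k\<in>S. z k))" by simp
  qed
  finally show ?thesis by (simp add: mlin_def sum_distrib_left)
qed

lemma mlin_pd:
  assumes "finite V" "k \<in> V"
  shows "mlin V (pd k c) z = mlin (V - {k}) (\<lambda>S. c (insert k S)) z"
proof -
  have "mlin V (pd k c) z = mlin (insert k (V - {k})) (pd k c) z"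
    using assms by (simp add: insert_absorb)
  also have "\<dots> = mlin (V - {k}) (\<lambda>S. c (insert k S)) z"
  proof -
    have "mlin (V - {k}) (\<lambda>S. pd k c (insert k S)) z = 0"
      by (simp add: pd_def mlin_def)
    moreover have "mlin (V - {k}) (pd k c) z = mlin (V - {k}) (\<lambda>S. c (insert k S)) z"
      unfolding mlin_def by (rule sum.cong) (auto simp: pd_def)
    ultimately show ?thesis
      using assms by (subst mlin_insert) auto
  qed
  finally show ?thesis .
qed

text \<open>A polynomial that is affine in \<open>z k\<close> equals its first-order Taylor
  expansion in that variable. With \<open>s = - r\<close> this turns \<open>1 - r \<partial>\<close>
  into a substitution.\<close>

lemma mlin_upd:
  assumes "finite V" "k \<in> V"
  shows "mlin V c (z(k := z k + s)) = mlin V c z + s * mlin V (pd k c) z"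
proof -
  have V: "V = insert k (V - {k})" using assms by auto
  have *: "mlin V c z' = mlin (V - {k}) c z' + z' k * mlin V (pd k c) z'" for z' :: "'a \<Rightarrow> 'b"
    unfolding mlin_pd[OF assms] using assms by (subst V, subst mlin_insert) auto
  have "mlin (V - {k}) c' (z(k := z k + s)) = mlin (V - {k}) c' z" for c'
    by (rule mlin_cong) auto
  then show ?thesis
    unfolding *[of z] *[of "z(k := z k + s)"] mlin_pd[OF assms] by (simp add: algebra_simps)
qed

lemma mlin_line_deriv:
  fixes z :: "'k \<Rightarrow> 'a::real_normed_field"
  assumes fin: "finite V"
  shows "((\<lambda>s. mlin V c (\<lambda>k. z k + s * of_real (v k))) has_field_derivative
           mlin V (dd V v c) (\<lambda>k. z k + s * of_real (v k))) (at s)"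
proof -
  let ?w = "\<lambda>k. z k + s * of_real (v k)"
  have "((\<lambda>s. mlin V c (\<lambda>k. z k + s * of_real (v k))) has_field_derivative
          (\<Sum>S\<in>Pow V. of_real (c S) * (\<Sum>k\<in>S. of_real (v k) * (\<Prod>j\<in>S-{k}. ?w j)))) (at s)"
    unfolding mlin_def
    by (intro DERIV_sum DERIV_cmult has_field_derivative_prod) (auto intro!: derivative_eq_intros)
  \<comment> \<open>The product rule sums over \<open>k \<in> S\<close>; padding with zeros to all
    of \<open>V\<close> allows the two sums to be swapped.\<close>
  also have "(\<Sum>S\<in>Pow V. of_real (c S) * (\<Sum>k\<in>S. of_real (v k) * (\<Prod>j\<in>S-{k}. ?w j)))
      = (\<Sum>S\<in>Pow V. \<Sum>k\<in>V. if k \<in> S then of_real (v k) * (of_real (c S) * (\<Prod>j\<in>S-{k}. ?w j)) else 0)"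
  proof (rule sum.cong[OF refl])
    fix S assume "S \<in> Pow V"
    then have "(\<Sum>k\<in>V. if k \<in> S then of_real (v k) * (of_real (c S) * (\<Prod>j\<in>S-{k}. ?w j)) else 0)
       = (\<Sum>k\<in>S. of_real (v k) * (of_real (c S) * (\<Prod>j\<in>S-{k}. ?w j)))"
      using fin by (subst sum.inter_restrict[symmetric]) (auto simp: Int_absorb1)
    then show "of_real (c S) * (\<Sum>k\<in>S. of_real (v k) * (\<Prod>j\<in>S-{k}. ?w j)) =
      (\<Sum>k\<in>V. if k \<in> S then of_real (v k) * (of_real (c S) * (\<Prod>j\<in>S-{k}. ?w j)) else 0)"
      by (simp add: sum_distrib_left mult.left_commute)
  qed
  also have "\<dots> = (\<Sum>k\<in>V. of_real (v k) * mlin V (pd k c) ?w)"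
  proof (subst sum.swap, rule sum.cong[OF refl])
    fix k assume k: "k \<in> V"
    have inj: "inj_on (insert k) (Pow (V - {k}))"
      by (auto simp: inj_on_def)
    have "(\<Sum>S\<in>Pow V. if k \<in> S then of_real (v k) * (of_real (c S) * (\<Prod>j\<in>S-{k}. ?w j)) else 0)
       = (\<Sum>S\<in>insert k ` Pow (V - {k}). of_real (v k) * (of_real (c S) * (\<Prod>j\<in>S-{k}. ?w j)))"
    proof -
      have "Pow V \<inter> {S. k \<in> S} = insert k ` Pow (V - {k})"
      proof safe
        fix S assume "S \<subseteq> V" "k \<in> S"
        then show "S \<in> insert k ` Pow (V - {k})"
          by (intro image_eqI[of _ _ "S - {k}"]) auto
      qed (use k in auto)
      then show ?thesis
        using fin by (subst \<open>Pow V \<inter> {S. k \<in> S} = _\<close>[symmetric], subst sum.inter_restrict) auto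
    qed
    also have "\<dots> = (\<Sum>S\<in>Pow (V - {k}). of_real (v k) * (of_real (c (insert k S)) * (\<Prod>j\<in>S. ?w j)))"
      unfolding sum.reindex[OF inj] comp_def by (rule sum.cong) (auto intro!: prod.cong)
    finally show "(\<Sum>S\<in>Pow V. if k \<in> S then of_real (v k) * (of_real (c S) * (\<Prod>j\<in>S-{k}. ?w j)) else 0)
        = of_real (v k) * mlin V (pd k c) ?w"
      unfolding mlin_pd[OF fin k] by (simp add: mlin_def sum_distrib_left)
  qed
  finally show ?thesis by (simp add: mlin_dd)
qed

lemma mlin_line_poly:
  fixes z :: "'k \<Rightarrow> 'a::real_normed_field"
  shows "\<exists>q. \<forall>s. poly q s = mlin V c (\<lambda>k. z k + s * of_real (v k))"
  by (rule exI[of _ "\<Sum>S\<in>Pow V. smult (of_real (c S)) (\<Prod>k\<in>S. [:z k, of_real (v k):])"])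
     (simp add: mlin_def poly_sum poly_prod)

text \<open>On a line the multivariate polynomial becomes univariate, which makes roots and their
  multiplicities available.\<close>

lemma mlin_line_poly_pderiv:
  fixes z :: "'k \<Rightarrow> 'a::real_normed_field"
  assumes "finite V"
  obtains q where "\<And>s. poly q s = mlin V c (\<lambda>k. z k + s * of_real (v k))"
    "\<And>s. poly (pderiv q) s = mlin V (dd V v c) (\<lambda>k. z k + s * of_real (v k))"
proof -
  obtain q where q: "\<And>s. poly q s = mlin V c (\<lambda>k. z k + s * of_real (v k))"
    using mlin_line_poly by metis
  have "poly (pderiv q) s = mlin V (dd V v c) (\<lambda>k. z k + s * of_real (v k))" for s
    using mlin_line_deriv[OF assms, of c z v s] poly_DERIV[of q s]
    unfolding q[symmetric] by (rule DERIV_unique[rotated])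
  with q that show ?thesis by blast
qed

lemma continuous_on_mlin [continuous_intros]:
  fixes f :: "'b::topological_space \<Rightarrow> 'k \<Rightarrow> 'a::real_normed_field"
  assumes "\<And>k. k \<in> V \<Longrightarrow> continuous_on A (\<lambda>x. f x k)"
  shows "continuous_on A (\<lambda>x. mlin V c (f x))"
  unfolding mlin_def by (intro continuous_intros) (use assms in auto)

text \<open>Induction on the variables: \<open>F\<close> is its value at \<open>z k = 0\<close> plus
  \<open>z k\<close> times the difference between \<open>z k = 1\<close> and \<open>z k = 0\<close>,
  and both parts are multiaffine in the remaining variables. Reality at real points makes the
  coefficients real.\<close>

lemma multiaffine_is_mlin:
  fixes F :: "('k \<Rightarrow> complex) \<Rightarrow> complex"
  assumes "finite V"
    and "\<And>z z'. (\<And>k. k \<in> V \<Longrightarrow> z k = z' k) \<Longrightarrow> F z = F z'"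
    and "\<And>z k s. k \<in> V \<Longrightarrow> F (z(k := s)) = F (z(k := 0)) + s * (F (z(k := 1)) - F (z(k := 0)))"
    and "\<And>x. F (\<lambda>k. of_real (x k)) \<in> \<real>"
  shows "\<exists>c. \<forall>z. F z = mlin V c z"
  using assms
proof (induction V arbitrary: F rule: finite_induct)
  case empty
  have "F z = F (\<lambda>k. of_real 0)" for z by (rule empty.prems) simp
  then have "F z = mlin {} (\<lambda>_. Re (F (\<lambda>k. of_real 0))) z" for z
    using empty.prems(3)[of "\<lambda>_. 0"] by (simp add: mlin_def)
  then show ?case by blast
next
  case (insert k V)
  have upd_real: "(\<lambda>j. complex_of_real (x j))(k := of_real a) = (\<lambda>j. of_real ((x(k := a)) j))" for x a
    by auto
  define F0 where "F0 = (\<lambda>z. F (z(k := 0)))"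
  define F1 where "F1 = (\<lambda>z. F (z(k := 1)) - F (z(k := 0)))"
  have "\<exists>c. \<forall>z. F0 z = mlin V c z"
  proof (rule insert.IH)
    fix z z' :: "'k \<Rightarrow> complex" assume "\<And>j. j \<in> V \<Longrightarrow> z j = z' j"
    then show "F0 z = F0 z'" unfolding F0_def by (intro insert.prems(1)) auto
  next
    fix z j s assume "j \<in> V"
    with insert.hyps have "j \<noteq> k" by auto
    with \<open>j \<in> V\<close> show "F0 (z(j := s)) = F0 (z(j := 0)) + s * (F0 (z(j := 1)) - F0 (z(j := 0)))"
      unfolding F0_def using insert.prems(2)[of j "z(k := 0)" s]
      by (simp only: fun_upd_twist[OF \<open>j \<noteq> k\<close>] insert_iff simp_thms)
  next
    fix x show "F0 (\<lambda>j. of_real (x j)) \<in> \<real>"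
      unfolding F0_def using upd_real[of x 0] insert.prems(3) by simp
  qed
  then obtain c0 where c0: "\<And>z. F0 z = mlin V c0 z" by blast
  have "\<exists>c. \<forall>z. F1 z = mlin V c z"
  proof (rule insert.IH)
    fix z z' :: "'k \<Rightarrow> complex" assume "\<And>j. j \<in> V \<Longrightarrow> z j = z' j"
    then show "F1 z = F1 z'" unfolding F1_def
      by (intro arg_cong2[where f = "(-)"] insert.prems(1)) auto
  next
    fix z j s assume "j \<in> V"
    with insert.hyps have "j \<noteq> k" by auto
    have *: "F (z(k := a, j := s)) = F (z(k := a, j := 0)) + s * (F (z(k := a, j := 1)) - F (z(k := a, j := 0)))"
      for a using insert.prems(2)[of j "z(k := a)" s] \<open>j \<in> V\<close> by blast
    show "F1 (z(j := s)) = F1 (z(j := 0)) + s * (F1 (z(j := 1)) - F1 (z(j := 0)))"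
      unfolding F1_def fun_upd_twist[OF \<open>j \<noteq> k\<close>] *[of 0] *[of 1] by algebra
  next
    fix x show "F1 (\<lambda>j. of_real (x j)) \<in> \<real>"
      unfolding F1_def using upd_real[of x 0] upd_real[of x 1] insert.prems(3) by (simp add: Reals_diff)
  qed
  then obtain c1 where c1: "\<And>z. F1 z = mlin V c1 z" by blast
  define c where "c = (\<lambda>S. if k \<in> S then c1 (S - {k}) else c0 S)"
  have "F z = mlin (insert k V) c z" for z
  proof -
    have "mlin V c z = mlin V c0 z" "mlin V (\<lambda>S. c (insert k S)) z = mlin V c1 z"
      unfolding mlin_def using insert.hyps
      by (auto intro!: sum.cong arg_cong[where f = c1] simp: c_def)
    moreover have "F z = F0 z + z k * F1 z"
      using insert.prems(2)[of k z "z k"] unfolding F0_def F1_def fun_upd_triv by blast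
    ultimately show ?thesis
      using insert.hyps by (simp add: mlin_insert c0 c1)
  qed
  then show ?case by blast
qed

section \<open>Stability\<close>

text \<open>The logarithmic derivative at \<open>0\<close> is the sum of \<open>1 / (- a)\<close>
  over the roots \<open>a\<close>, all of which lie in the lower half plane. The first alternative
  covers constant \<open>q\<close>.\<close>

lemma poly_log_deriv_upper:
  fixes q :: "complex poly"
  assumes "\<And>s. Im s \<ge> 0 \<Longrightarrow> poly q s \<noteq> 0"
  shows "poly (pderiv q) 0 / poly q 0 = 0 \<or> Im (poly (pderiv q) 0 / poly q 0) < 0"
  using assms
proof (induction "degree q" arbitrary: q)
  case 0
  then have "pderiv q = 0" by (simp add: pderiv_eq_0_iff)
  then show ?case by simp
next
  case (Suc n)
  have "\<not> constant (poly q)"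
    using Suc.hyps(2) by (simp add: constant_degree)
  then obtain a where a: "poly q a = 0" using fundamental_theorem_of_algebra by blast
  then have Ima: "Im a < 0" using Suc.prems[of a] by linarith
  obtain p where p: "q = [:- a, 1:] * p" using a by (auto simp: poly_eq_0_iff_dvd dvd_def)
  have nz: "\<And>s. Im s \<ge> 0 \<Longrightarrow> poly p s \<noteq> 0" using Suc.prems by (auto simp: p)
  moreover have "n = degree p"
  proof -
    have "p \<noteq> 0" using nz[of 0] by auto
    then have "degree q = Suc (degree p)" unfolding p by (subst degree_mult_eq) auto
    with Suc.hyps(2) show ?thesis by simp
  qed
  ultimately have IH: "poly (pderiv p) 0 / poly p 0 = 0 \<or> Im (poly (pderiv p) 0 / poly p 0) < 0"
    using Suc.hyps(1) by blast
  have "a \<noteq> 0" using Ima by auto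
  have "poly (pderiv q) 0 / poly q 0 = poly (pderiv p) 0 / poly p 0 + 1 / (- a)"
    using nz[of 0] \<open>a \<noteq> 0\<close> unfolding p by (simp add: pderiv_pCons pderiv_diff pderiv_smult field_simps)
  moreover have "Im (1 / (- a)) < 0"
    using Ima \<open>a \<noteq> 0\<close> by (simp add: Im_divide divide_neg_pos sum_power2_gt_zero_iff complex_eq_iff)
  ultimately show ?case using IH by auto
qed

definition stable :: "'k set \<Rightarrow> ('k set \<Rightarrow> real) \<Rightarrow> bool" where
  "stable V c \<longleftrightarrow> (\<forall>z::'k \<Rightarrow> complex. (\<forall>k\<in>V. Im (z k) > 0) \<longrightarrow> mlin V c z \<noteq> 0)"

text \<open>For \<open>Im s \<ge> 0\<close> every coordinate of \<open>z + s u\<close> stays in the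
  open upper half plane, so the restriction to this line has all its roots below the real
  axis.\<close>

lemma stable_log_deriv:
  fixes z :: "'k \<Rightarrow> complex"
  assumes "finite V" "stable V c" "\<forall>k\<in>V. u k \<ge> 0" "\<forall>k\<in>V. Im (z k) > 0"
  shows "mlin V (dd V u c) z / mlin V c z = 0 \<or> Im (mlin V (dd V u c) z / mlin V c z) < 0"
proof -
  obtain q where q: "\<And>s. poly q s = mlin V c (\<lambda>k. z k + s * of_real (u k))"
    "\<And>s. poly (pderiv q) s = mlin V (dd V u c) (\<lambda>k. z k + s * of_real (u k))"
    using mlin_line_poly_pderiv[OF assms(1), of c z u] by blast
  have "poly q s \<noteq> 0" if "Im s \<ge> 0" for s
    unfolding q(1) using assms that
    by (intro assms(2)[unfolded stable_def, rule_format]) (simp add: add_pos_nonneg)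
  from poly_log_deriv_upper[OF this] show ?thesis by (simp add: q)
qed

text \<open>A zero of \<open>p - D_u p\<close> at a point with \<open>p \<noteq> 0\<close> would
  need \<open>D_u p / p = 1\<close>, but this quotient is zero or not real.\<close>

lemma stable_one_minus_dd:
  assumes "finite V" "stable V c" "\<forall>k\<in>V. u k \<ge> 0"
  shows "stable V (one_minus_dd V u c)"
  unfolding stable_def
proof (intro allI impI)
  fix z :: "_ \<Rightarrow> complex" assume z: "\<forall>k\<in>V. Im (z k) > 0"
  then have nz: "mlin V c z \<noteq> 0" using assms(2) by (simp add: stable_def)
  from stable_log_deriv[OF assms, of z] z
  have "mlin V (dd V u c) z / mlin V c z \<noteq> 1" by auto
  with nz show "mlin V (one_minus_dd V u c) z \<noteq> 0" by (simp add: mlin_one_minus_dd)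
qed

text \<open>The estimate in the open half plane passes to the limit when all variables are shifted
  by \<open>\<i> e\<close> and \<open>e\<close> tends to \<open>0\<close> from above.\<close>

lemma stable_log_deriv_closure:
  fixes z :: "'k \<Rightarrow> complex"
  assumes "finite V" "stable V c" "\<forall>k\<in>V. u k \<ge> 0" "\<forall>k\<in>V. Im (z k) \<ge> 0"
    and "mlin V c z \<noteq> 0"
  shows "Im (mlin V (dd V u c) z / mlin V c z) \<le> 0"
proof -
  define Z where "Z = (\<lambda>(e::real) k. z k + \<i> * of_real e)"
  have cont: "isCont (\<lambda>e. mlin V c' (Z e)) 0" for c'
    using continuous_on_mlin[of V UNIV Z c']
    by (intro continuous_on_interior[of UNIV]) (auto simp: Z_def intro!: continuous_intros)
  have Z0: "Z 0 = z" by (simp add: Z_def)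
  have "((\<lambda>e. Im (mlin V (dd V u c) (Z e) / mlin V c (Z e))) \<longlongrightarrow>
           Im (mlin V (dd V u c) (Z 0) / mlin V c (Z 0))) (at_right 0)"
    using cont assms(5) unfolding Z0[symmetric]
    by (intro tendsto_intros) (auto simp: isCont_def Z0 intro: tendsto_within_subset)
  moreover have "\<forall>\<^sub>F e in at_right (0::real). Im (mlin V (dd V u c) (Z e) / mlin V c (Z e)) \<le> 0"
  proof (rule eventually_at_right_less[THEN eventually_mono])
    fix e :: real assume "0 < e"
    then have "\<forall>k\<in>V. Im (Z e k) > 0" using assms(4) by (simp add: Z_def add_nonneg_pos)
    from stable_log_deriv[OF assms(1-3) this]
    show "Im (mlin V (dd V u c) (Z e) / mlin V c (Z e)) \<le> 0" by auto
  qed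
  ultimately show ?thesis unfolding Z0 by (rule tendsto_upperbound) simp
qed

text \<open>Just below a zero in the upper half plane the logarithmic derivative would have positive
  imaginary part.\<close>

lemma stable_line_nonzero:
  fixes y :: "'k \<Rightarrow> real" and s :: complex
  assumes "finite V" "stable V c" "\<forall>k\<in>V. v k \<ge> 0" "mlin V c y \<noteq> 0" "Im s > 0"
  shows "mlin V c (\<lambda>k. of_real (y k) + s * of_real (v k)) \<noteq> 0"
proof
  assume zero: "mlin V c (\<lambda>k. of_real (y k) + s * of_real (v k)) = 0"
  obtain q :: "complex poly" where q: "\<And>s. poly q s = mlin V c (\<lambda>k. of_real (y k) + s * of_real (v k))"
    "\<And>s. poly (pderiv q) s = mlin V (dd V v c) (\<lambda>k. of_real (y k) + s * of_real (v k))"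
    using mlin_line_poly_pderiv[OF assms(1), of c "\<lambda>k. complex_of_real (y k)" v] by blast
  \<comment> \<open>Since \<open>v\<close> may have zero coordinates, the line need not enter the
    open half plane in every variable. The value at the real base point shows that \<open>q\<close>
    does not vanish identically.\<close>
  have "poly q 0 \<noteq> 0" using assms(4) by (simp add: q mlin_of_real)
  then have "q \<noteq> 0" by auto
  define m where "m = order s q"
  obtain p where p: "q = [:- s, 1:] ^ m * p" "\<not> [:- s, 1:] dvd p"
    using order_decomp[OF \<open>q \<noteq> 0\<close>] unfolding m_def by blast
  then have ps: "poly p s \<noteq> 0" by (simp add: poly_eq_0_iff_dvd)
  have m: "m > 0" using zero \<open>q \<noteq> 0\<close> unfolding m_def q(1)[symmetric] by (simp add: order_root)
  then obtain m' where m': "m = Suc m'" using gr0_conv_Suc by auto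
  define S where "S = (\<lambda>e::real. s - \<i> * of_real e)"
  \<comment> \<open>Splitting off the zero of order \<open>m\<close> leaves \<open>L\<close>, which
    is bounded near \<open>s\<close>. The pole contributes imaginary part \<open>m / e\<close>, so
    \<open>e * norm (L e) < 1\<close> suffices for a positive total.\<close>
  define L where "L = (\<lambda>e. poly (pderiv p) (S e) / poly p (S e))"
  have "isCont (\<lambda>e. poly p' (S e)) 0" for p'
    unfolding S_def by (intro continuous_intros)
  then have "isCont (\<lambda>e. e * norm (L e)) 0" "isCont (\<lambda>e. norm (poly p (S e))) 0"
    unfolding L_def using ps by (auto intro!: continuous_intros simp: S_def)
  then have "((\<lambda>e. e * norm (L e)) \<longlongrightarrow> 0 * norm (L 0)) (at_right 0)"
    "((\<lambda>e. norm (poly p (S e))) \<longlongrightarrow> norm (poly p (S 0))) (at_right 0)"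
    unfolding isCont_def by (auto intro: tendsto_within_subset)
  then have "\<forall>\<^sub>F e in at_right 0. e * norm (L e) < 1"
     "\<forall>\<^sub>F e in at_right 0. 0 < norm (poly p (S e))"
    using order_tendstoD(2)[where a = 1] order_tendstoD(1)[where a = 0] ps
    by (force simp: S_def)+
  moreover have "\<forall>\<^sub>F e in at_right 0. e < Im s"
    using assms(5) by (rule eventually_at_right_real[THEN eventually_mono]) auto
  ultimately have "\<forall>\<^sub>F e in at_right (0::real). e * norm (L e) < 1 \<and> 0 < norm (poly p (S e)) \<and> e < Im s \<and> 0 < e"
    using eventually_at_right_less[of "0::real"] by eventually_elim auto
  then obtain e where e: "e * norm (L e) < 1" "poly p (S e) \<noteq> 0" "e < Im s" "0 < e"
    using eventually_happens[of _ "at_right (0::real)"] by (auto simp: trivial_limit_at_right_real)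
  have nz: "S e - s \<noteq> 0" using e by (simp add: S_def)
  have qS: "poly q (S e) \<noteq> 0" using e nz by (simp add: p poly_power)
  have d1: "poly (pderiv q) t = of_nat m * (t - s) ^ m' * poly p t + (t - s) ^ m * poly (pderiv p) t" for t
    unfolding p(1) pderiv_mult m' pderiv_power_Suc poly_add poly_mult poly_power poly_smult
    by (simp add: pderiv_pCons del: power_Suc)
  have d2: "poly q t = (t - s) * (t - s) ^ m' * poly p t" for t
    by (simp add: p(1) m' poly_power left_diff_distrib)
  have "poly (pderiv q) (S e) / poly q (S e) = of_nat m / (S e - s) + L e"
    unfolding d1 d2 L_def m' using e(2) nz by (simp add: divide_simps) (simp add: algebra_simps)
  moreover have "Im (of_nat m / (S e - s)) = m / e"
    using e by (simp add: S_def Im_divide power2_eq_square)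
  moreover have "1 / e \<le> m / e" using m e by (simp add: divide_right_mono)
  moreover have "norm (L e) < 1 / e" using e by (simp add: field_simps)
  moreover have "\<bar>Im (L e)\<bar> \<le> norm (L e)" by (rule abs_Im_le_cmod)
  ultimately have "Im (poly (pderiv q) (S e) / poly q (S e)) > 0" by simp
  moreover have "Im (poly (pderiv q) (S e) / poly q (S e)) \<le> 0"
    unfolding q using e assms(3) qS[unfolded q]
    by (intro stable_log_deriv_closure[OF assms(1-3)]) (auto simp: S_def)
  ultimately show False by simp
qed

section \<open>Functions on the slit plane with values in the lower half plane\<close>

text \<open>On the circle \<open>z = r w\<close> with \<open>\<bar>w\<bar> = 1\<close> the kernel \<open>2 Im w - l Im w\<^sup>2 = 2 Im w (1 - l Re w)\<close> has
  the sign of \<open>Im w\<close>, and integrating \<open>F\<close> against it picks out the first two Taylor coefficients.\<close>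

lemma typically_real_coeff:
  fixes F :: "complex \<Rightarrow> complex"
  assumes hol: "F holomorphic_on ball 0 1"
    and up: "\<And>z. z \<in> ball 0 1 \<Longrightarrow> Im z > 0 \<Longrightarrow> Im (F z) \<le> 0"
    and low: "\<And>z. z \<in> ball 0 1 \<Longrightarrow> Im z < 0 \<Longrightarrow> Im (F z) \<ge> 0"
    and r: "0 < r" "r < 1" and l: "0 \<le> l" "l \<le> 1"
  shows "2 * r * Re (deriv F 0) \<le> l * r\<^sup>2 * Re (deriv (deriv F) 0) / 2"
proof -
  have cont: "continuous_on (cball 0 r) F"
    using r by (intro holomorphic_on_imp_continuous_on holomorphic_on_subset[OF hol]) auto
  have holr: "F holomorphic_on ball 0 r"
    using r by (intro holomorphic_on_subset[OF hol]) auto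
  have i1: "((\<lambda>z. F z / z ^ 2) has_contour_integral 2 * pi * \<i> * deriv F 0) (circlepath 0 r)"
    using Cauchy_has_contour_integral_higher_derivative_circlepath[OF cont holr, of 0 1] r
    by (simp add: power2_eq_square)
  have i2: "((\<lambda>z. F z / z ^ 3) has_contour_integral 2 * pi * \<i> * deriv (deriv F) 0 / 2) (circlepath 0 r)"
    using Cauchy_has_contour_integral_higher_derivative_circlepath[OF cont holr, of 0 2] r
    by (simp add: numeral_2_eq_2 numeral_3_eq_3 mult.assoc)
  \<comment> \<open>These vanishing integrals supply the positive powers of \<open>w\<close> in the
    kernel; the Taylor coefficients come with the negative powers.\<close>
  have j: "((\<lambda>z. F z * z ^ k) has_contour_integral 0) (circlepath 0 r)" for k
    using r by (intro Cauchy_theorem_disc_simple[of _ 0 1])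
      (auto intro!: holomorphic_intros hol simp: path_image_circlepath)
  have j0: "(F has_contour_integral 0) (circlepath 0 r)" using j[of 0] by simp
  have j1: "((\<lambda>z. F z * z) has_contour_integral 0) (circlepath 0 r)" using j[of 1] by simp
  define I where "I = 1 / (2 * \<i> * (2 * pi * \<i>)) * (complex_of_real (2 / r) * 0 - 2 * r * (2 * pi * \<i> * deriv F 0)
     - l * (complex_of_real (1 / r\<^sup>2) * 0 - r\<^sup>2 * (2 * pi * \<i> * deriv (deriv F) 0 / 2)))"
  define K where "K = (\<lambda>z. 1 / (2 * \<i> * (2 * pi * \<i>)) * (2 / r * F z - 2 * r * (F z / z ^ 2)
     - l * (1 / r\<^sup>2 * (F z * z) - r\<^sup>2 * (F z / z ^ 3))))"
  have "(K has_contour_integral I) (circlepath 0 r)"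
    unfolding K_def I_def
    by (intro has_contour_integral_lmul has_contour_integral_diff i1 i2 j0 j1)
  then have "((\<lambda>x. K (circlepath 0 r x) * (2 * pi * \<i> * r * exp (2 * of_real pi * \<i> * x)))
        has_integral I) {0..1}"
    unfolding has_contour_integral_def
    by (rule has_integral_spike_finite[of "{0, 1}", rotated 2])
       (auto simp: vector_derivative_circlepath01)
  then have int: "((\<lambda>x. Im (K (circlepath 0 r x) * (2 * pi * \<i> * r * exp (2 * of_real pi * \<i> * x))))
        has_integral Im I) {0..1}"
    using has_integral_linear[OF _ bounded_linear_Im] unfolding o_def by blast
  have "Im (K (circlepath 0 r x) * (2 * pi * \<i> * r * exp (2 * of_real pi * \<i> * x))) \<le> 0" for x
  proof -
    define w where "w = exp (2 * of_real pi * \<i> * x)"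
    have nw: "norm w = 1" unfolding w_def by (simp add: norm_exp_eq_Re)
    then have "w \<noteq> 0" by auto
    have inv: "1 / w = cnj w" using nw by (metis complex_div_cnj mult_1 of_real_1 div_by_1 power_one)
    define z where "z = of_real r * w"
    have z: "circlepath 0 r x = z" by (simp add: circlepath z_def w_def)
    have "K z * (2 * pi * \<i> * z) = F z * ((2 * (w - 1 / w) - l * (w\<^sup>2 - (1 / w)\<^sup>2)) / (2 * \<i>))"
      using r \<open>w \<noteq> 0\<close> unfolding K_def z_def
      by (simp add: field_simps power2_eq_square power3_eq_cube)
    also have "(2 * (w - 1 / w) - l * (w\<^sup>2 - (1 / w)\<^sup>2)) / (2 * \<i>) = of_real (2 * Im w * (1 - l * Re w))"
    proof -
      have "2 * (w - 1 / w) - l * (w\<^sup>2 - (1 / w)\<^sup>2) = of_real (2 * Im w * (1 - l * Re w)) * (2 * \<i>)"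
        unfolding inv by (simp add: complex_eq_iff power2_eq_square algebra_simps)
      then show ?thesis by simp
    qed
    finally have "Im (K z * (2 * pi * \<i> * z)) = Im (F z * of_real (2 * Im w * (1 - l * Re w)))"
      by (rule arg_cong)
    also have "\<dots> = Im (F z) * (2 * Im w * (1 - l * Re w))"
      by (simp add: times_complex.sel)
    also have "\<dots> \<le> 0"
    proof -
      have "Re w \<le> 1" using nw complex_Re_le_cmod[of w] by simp
      then have "1 - l * Re w \<ge> 0" using l
        by (smt (verit) mult_left_le mult_nonneg_nonpos mult.commute)
      moreover have "Im (F z) * Im w \<le> 0"
      proof -
        have "z \<in> ball 0 1" using r nw by (simp add: z_def norm_mult)
        moreover have "Im z = r * Im w" by (simp add: z_def)
        ultimately show ?thesis using up[of z] low[of z] r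
          by (cases "Im w" "0::real" rule: linorder_cases)
             (auto simp: mult_nonneg_nonpos mult_nonpos_nonneg zero_less_mult_iff mult_less_0_iff mult_le_0_iff)
      qed
      ultimately show ?thesis
        using mult_nonpos_nonneg[of "Im (F z) * Im w" "2 * (1 - l * Re w)"] by (simp add: mult_ac)
    qed
    finally show ?thesis unfolding z by (simp add: z_def w_def mult.assoc)
  qed
  then have "Im I \<le> 0"
    using has_integral_le[OF int has_integral_0] by auto
  moreover have "I = \<i> * (r * deriv F 0 - l * r\<^sup>2 * deriv (deriv F) 0 / 4)"
    unfolding I_def by (simp add: field_simps)
  ultimately show ?thesis by simp
qed

definition slit_plane :: "complex set" where
  "slit_plane = {t. Im t \<noteq> 0 \<or> Re t > 0}"

lemma open_slit_plane: "open slit_plane"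
  unfolding slit_plane_def
  by (intro open_Collect_disj open_Collect_neq open_Collect_less continuous_intros)

text \<open>The Koebe-type map \<open>z \<mapsto> x ((1 + z) / (1 - z))\<^sup>2\<close> sends the unit disc onto the slit plane and
  \<open>0\<close> to \<open>x\<close>. With it the extremal coefficient bound becomes exactly \<open>R'' \<ge> 0\<close>.\<close>

lemma slit_plane_deriv_signs:
  fixes R :: "complex \<Rightarrow> complex"
  assumes hol: "R holomorphic_on slit_plane"
    and cnj: "\<And>t. t \<in> slit_plane \<Longrightarrow> R (cnj t) = cnj (R t)"
    and up: "\<And>t. Im t > 0 \<Longrightarrow> Im (R t) \<le> 0"
    and x: "x > 0"
  shows "Re (deriv R (of_real x)) \<le> 0" "Re (deriv (deriv R) (of_real x)) \<ge> 0"
proof -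
  define m where "m = (\<lambda>z::complex. (1 + z) / (1 - z))"
  define h where "h = (\<lambda>z. of_real x * (m z)\<^sup>2)"
  define F where "F = (\<lambda>z. R (h z))"
  have nz: "1 - z \<noteq> 0" if "z \<in> ball 0 1" for z :: complex using that by auto
  have Re_m: "Re (m z) > 0" if "z \<in> ball 0 1" for z
  proof -
    have "Re (m z) = (1 - (cmod z)\<^sup>2) / (cmod (1 - z))\<^sup>2"
      unfolding cmod_power2 by (simp add: m_def Re_divide algebra_simps power2_eq_square)
    moreover have "(cmod z)\<^sup>2 < 1" using that by (simp add: abs_square_less_1)
    ultimately show ?thesis using nz[OF that] by simp
  qed
  have Im_m: "Im (m z) = 2 * Im z / (cmod (1 - z))\<^sup>2" for z
    by (simp add: m_def Im_divide cmod_power2 algebra_simps)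
  have Im_h: "Im (h z) = 2 * x * Re (m z) * Im (m z)" for z
    by (simp add: h_def power2_eq_square algebra_simps)
  have h_slit: "h z \<in> slit_plane" if "z \<in> ball 0 1" for z
  proof (cases "Im (m z) = 0")
    case True
    then have "Re (h z) = x * (Re (m z))\<^sup>2" by (simp add: h_def power2_eq_square)
    then show ?thesis using Re_m[OF that] x by (simp add: slit_plane_def)
  qed (use Im_h[of z] Re_m[OF that] x in \<open>simp add: slit_plane_def\<close>)
  have sgn: "Im (h z) > 0 \<longleftrightarrow> Im z > 0" "Im (h z) < 0 \<longleftrightarrow> Im z < 0" if "z \<in> ball 0 1" for z
    unfolding Im_h Im_m using Re_m[OF that] x nz[OF that]
    by (auto simp: zero_less_mult_iff zero_less_divide_iff mult_less_0_iff divide_less_0_iff)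
  have holh: "h holomorphic_on ball 0 1"
    unfolding h_def m_def by (intro holomorphic_intros) (use nz in auto)
  have holF: "F holomorphic_on ball 0 1"
    using holomorphic_on_compose_gen[OF holh hol] h_slit by (force simp: F_def o_def)
  have up': "Im (F z) \<le> 0" if "z \<in> ball 0 1" "Im z > 0" for z
    using that sgn up by (simp add: F_def)
  have low': "Im (F z) \<ge> 0" if "z \<in> ball 0 1" "Im z < 0" for z
  proof -
    have "Im (h z) < 0" using that sgn by blast
    then show ?thesis using up[of "cnj (h z)"] cnj[OF h_slit[OF that(1)]] by (simp add: F_def)
  qed
  have dh: "(h has_field_derivative (4 * of_real x * (1 + z) / (1 - z) ^ 3)) (at z)" if "z \<in> ball 0 1" for z
    unfolding h_def m_def using nz[OF that]
    by (auto intro!: derivative_eq_intros simp: divide_simps)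
       (simp add: eval_nat_numeral algebra_simps)
  have dR: "(R has_field_derivative deriv R t) (at t)"
    "(deriv R has_field_derivative deriv (deriv R) t) (at t)" if "t \<in> slit_plane" for t
    using that hol open_slit_plane holomorphic_deriv[OF hol] by (auto intro: holomorphic_derivI)
  have dF: "(F has_field_derivative (deriv R (h z) * (4 * of_real x * (1 + z) / (1 - z) ^ 3))) (at z)"
    if "z \<in> ball 0 1" for z
    unfolding F_def using DERIV_chain2[OF dR(1)[OF h_slit] dh] that by blast
  have h0: "h 0 = of_real x" by (simp add: h_def m_def)
  have F1: "deriv F 0 = 4 * x * deriv R x"
    using DERIV_imp_deriv[OF dF[of 0]] by (simp add: h0)
  have "((\<lambda>z. deriv R (h z) * (4 * of_real x * (1 + z) / (1 - z) ^ 3)) has_field_derivative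
          (16 * x\<^sup>2 * deriv (deriv R) x + 16 * x * deriv R x)) (at 0)"
  proof -
    have "((\<lambda>z. deriv R (h z)) has_field_derivative deriv (deriv R) x * (4 * x)) (at 0)"
      using DERIV_chain2[OF dR(2)[OF h_slit] dh, of 0] by (simp add: h0)
    moreover have "((\<lambda>z::complex. 4 * of_real x * (1 + z) / (1 - z) ^ 3) has_field_derivative 16 * x) (at 0)"
      by (auto intro!: derivative_eq_intros)
    ultimately show ?thesis
      using DERIV_mult by (fastforce simp: h0 algebra_simps power2_eq_square)
  qed
  moreover have "(deriv F has_field_derivative D) (at 0)"
    if "((\<lambda>z. deriv R (h z) * (4 * of_real x * (1 + z) / (1 - z) ^ 3)) has_field_derivative D) (at 0)" for D
    using that open_ball
    by (rule has_field_derivative_transform_within_open[where S = "ball 0 1"])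
       (use DERIV_imp_deriv[OF dF] in auto)
  ultimately have F2: "deriv (deriv F) 0 = 16 * x\<^sup>2 * deriv (deriv R) x + 16 * x * deriv R x"
    using DERIV_imp_deriv by blast
  have ineq: "2 * r * Re (deriv F 0) \<le> l * r\<^sup>2 * Re (deriv (deriv F) 0) / 2"
    if "0 < r" "r < 1" "0 \<le> l" "l \<le> 1" for r l
    using typically_real_coeff[OF holF up' low' that] .
  \<comment> \<open>Setting \<open>l = 0\<close> removes the second coefficient and leaves the sign
    of \<open>R'\<close>.\<close>
  from ineq[of "1/2" 0] x show "Re (deriv R (of_real x)) \<le> 0"
    by (simp add: F1 mult_le_0_iff)
  \<comment> \<open>With \<open>l = 1\<close> and \<open>r\<close> tending to \<open>1\<close> the
    inequality reads \<open>8 x R' \<le> 8 x\<^sup>2 R'' + 8 x R'\<close>, where \<open>R'\<close>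
    cancels.\<close>
  have "2 * Re (deriv F 0) \<le> Re (deriv (deriv F) 0) / 2"
  proof (rule tendsto_le[OF trivial_limit_at_left_real])
    show "((\<lambda>r. r\<^sup>2 * Re (deriv (deriv F) 0) / 2) \<longlongrightarrow> Re (deriv (deriv F) 0) / 2) (at_left 1)"
      by (auto intro!: tendsto_eq_intros)
    show "((\<lambda>r. 2 * r * Re (deriv F 0)) \<longlongrightarrow> 2 * Re (deriv F 0)) (at_left 1)"
      by (auto intro!: tendsto_eq_intros)
    show "\<forall>\<^sub>F r in at_left 1. 2 * r * Re (deriv F 0) \<le> r\<^sup>2 * Re (deriv (deriv F) 0) / 2"
      using eventually_at_left_real[of 0 "1::real"]
      by (rule eventually_mono) (use ineq[of _ 1] in auto)
  qed
  then have "0 \<le> 8 * x\<^sup>2 * Re (deriv (deriv R) x)"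
    by (simp add: F1 F2)
  then show "Re (deriv (deriv R) (of_real x)) \<ge> 0"
    using x by (simp add: zero_le_mult_iff)
qed

section \<open>The barrier argument\<close>

text \<open>In the terminology of Marcus, Spielman and Srivastava: \<open>y\<close> lies above the roots.\<close>

definition zero_free_above :: "'k set \<Rightarrow> ('k set \<Rightarrow> real) \<Rightarrow> ('k \<Rightarrow> real) \<Rightarrow> bool" where
  "zero_free_above V c y \<longleftrightarrow> (\<forall>x::'k \<Rightarrow> real. (\<forall>k\<in>V. y k \<le> x k) \<longrightarrow> mlin V c x \<noteq> 0)"

definition barrier :: "'k set \<Rightarrow> ('k \<Rightarrow> real) \<Rightarrow> ('k set \<Rightarrow> real) \<Rightarrow> ('k \<Rightarrow> real) \<Rightarrow> real" where
  "barrier V u c x = mlin V (dd V u c) x / mlin V c x"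

lemma zero_free_aboveD:
  "zero_free_above V c y \<Longrightarrow> (\<forall>k\<in>V. y k \<le> x k) \<Longrightarrow> mlin V c x \<noteq> 0"
  by (simp add: zero_free_above_def)

lemma zero_free_above_mono:
  "zero_free_above V c y \<Longrightarrow> (\<forall>k\<in>V. y k \<le> x k) \<Longrightarrow> zero_free_above V c x"
  unfolding zero_free_above_def by (meson order_trans)

lemma has_real_derivative_Re:
  assumes "(R has_field_derivative D) (at (of_real x))"
  shows "((\<lambda>t. Re (R (of_real t))) has_real_derivative Re D) (at x)"
proof -
  have "((\<lambda>t. R (of_real t)) has_vector_derivative D) (at x)"
    using has_vector_derivative_real_field[OF assms] by simp
  from bounded_linear.has_vector_derivative[OF bounded_linear_Re this] show ?thesis
    by (simp add: has_real_derivative_iff_has_vector_derivative)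
qed

text \<open>Extended to complex \<open>t\<close>, the barrier is a quotient \<open>R\<close> without
  poles on the slit plane: off the real axis by stability and conjugation, on the positive axis by
  \<open>zero_free_above\<close>. It maps the upper half plane into the closed lower one, so
  \<open>slit_plane_deriv_signs\<close> applies.\<close>

lemma barrier_ray:
  fixes y :: "'k \<Rightarrow> real"
  assumes fin: "finite V" and st: "stable V c" and zf: "zero_free_above V c y"
    and u: "\<forall>k\<in>V. u k \<ge> 0" and v: "\<forall>k\<in>V. v k \<ge> 0"
  obtains \<phi>' \<phi>'' where
    "\<And>t. t > 0 \<Longrightarrow> ((\<lambda>t. barrier V u c (\<lambda>k. y k + t * v k)) has_real_derivative \<phi>' t) (at t)"
    "\<And>t. t > 0 \<Longrightarrow> (\<phi>' has_real_derivative \<phi>'' t) (at t)"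
    "\<And>t. t > 0 \<Longrightarrow> \<phi>' t \<le> 0" "\<And>t. t > 0 \<Longrightarrow> \<phi>'' t \<ge> 0"
proof -
  define p where "p = (\<lambda>c' (t::complex). mlin V c' (\<lambda>k. of_real (y k) + t * of_real (v k)))"
  define R where "R = (\<lambda>t. p (dd V u c) t / p c t)"
  have p_real: "p c' (of_real t) = of_real (mlin V c' (\<lambda>k. y k + t * v k))" for c' t
    unfolding p_def mlin_of_real[symmetric] by simp
  have p_cnj: "p c' (cnj t) = cnj (p c' t)" for c' t
    unfolding p_def mlin_cnj[symmetric] by simp
  have nz0: "mlin V c y \<noteq> 0" using zf by (rule zero_free_aboveD) simp
  have nz_up: "p c t \<noteq> 0" if "Im t > 0" for t
    unfolding p_def by (rule stable_line_nonzero[OF fin st v nz0 that])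
  have nz: "p c t \<noteq> 0" if "t \<in> slit_plane" for t
  proof -
    consider "Im t > 0" | "Im t < 0" | "Im t = 0" "Re t > 0"
      using \<open>t \<in> slit_plane\<close> by (force simp: slit_plane_def)
    then show ?thesis
    proof cases
      case 2
      then show ?thesis using nz_up[of "cnj t"] by (simp add: p_cnj)
    next
      case 3
      then have "t = of_real (Re t)" by (simp add: complex_eq_iff)
      moreover have "mlin V c (\<lambda>k. y k + Re t * v k) \<noteq> 0"
        using zf by (rule zero_free_aboveD) (use 3 v in simp)
      ultimately show ?thesis using p_real by (metis of_real_eq_0_iff)
    qed (rule nz_up)
  qed
  have "(p c' has_field_derivative p (dd V v c') t) (at t)" for c' t
    unfolding p_def by (rule mlin_line_deriv[OF fin])
  then have hol_p: "p c' holomorphic_on A" for c' A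
    unfolding holomorphic_on_def field_differentiable_def
    using has_field_derivative_at_within by blast
  have hol: "R holomorphic_on slit_plane"
    unfolding R_def using nz by (intro holomorphic_intros hol_p)
  have cnj: "R (cnj t) = cnj (R t)" for t
    by (simp add: R_def p_cnj)
  have up: "Im (R t) \<le> 0" if "Im t > 0" for t
    using nz_up[OF that] that v unfolding R_def p_def
    by (intro stable_log_deriv_closure[OF fin st u]) auto
  note signs = slit_plane_deriv_signs[OF hol cnj up]
  have slit: "complex_of_real t \<in> slit_plane" if "t > 0" for t
    using that by (simp add: slit_plane_def)
  have eq: "barrier V u c (\<lambda>k. y k + t * v k) = Re (R (of_real t))" for t
    by (simp add: R_def barrier_def p_real flip: of_real_divide)
  show ?thesis
  proof (rule that)
    fix t :: real assume t: "t > 0"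
    show "((\<lambda>t. barrier V u c (\<lambda>k. y k + t * v k)) has_real_derivative Re (deriv R t)) (at t)"
      unfolding eq using holomorphic_derivI[OF hol open_slit_plane slit[OF t]]
      by (rule has_real_derivative_Re)
    show "((\<lambda>t. Re (deriv R (complex_of_real t))) has_real_derivative Re (deriv (deriv R) t)) (at t)"
      using holomorphic_derivI[OF holomorphic_deriv[OF hol open_slit_plane] open_slit_plane slit[OF t]]
      by (rule has_real_derivative_Re)
    show "Re (deriv R t) \<le> 0" "Re (deriv (deriv R) t) \<ge> 0" using signs t by auto
  qed
qed

lemma barrier_ray_deriv:
  fixes y :: "'k \<Rightarrow> real"
  assumes "finite V" "mlin V c (\<lambda>k. y k + t * v k) \<noteq> 0"
  shows "((\<lambda>t. barrier V u c (\<lambda>k. y k + t * v k)) has_real_derivative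
     (mlin V (dd V v (dd V u c)) (\<lambda>k. y k + t * v k) * mlin V c (\<lambda>k. y k + t * v k)
      - mlin V (dd V u c) (\<lambda>k. y k + t * v k) * mlin V (dd V v c) (\<lambda>k. y k + t * v k))
     / (mlin V c (\<lambda>k. y k + t * v k) * mlin V c (\<lambda>k. y k + t * v k))) (at t)"
  unfolding barrier_def
  using DERIV_divide[OF mlin_line_deriv[OF assms(1), of "dd V u c" y v t]
      mlin_line_deriv[OF assms(1), of c y v t]] assms(2) by simp

text \<open>By convexity the tangent at \<open>d\<close> lies below the graph at \<open>0\<close>.
  This is the quantitative gain behind \<open>barrier_shift\<close>.\<close>

lemma barrier_ray_tangent:
  fixes y :: "'k \<Rightarrow> real"
  assumes fin: "finite V" and st: "stable V c" and zf: "zero_free_above V c y"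
    and u: "\<forall>k\<in>V. u k \<ge> 0" and v: "\<forall>k\<in>V. v k \<ge> 0" and d: "d > 0"
    and D: "((\<lambda>t. barrier V u c (\<lambda>k. y k + t * v k)) has_real_derivative D) (at d)"
  shows "D \<le> 0" "barrier V u c (\<lambda>k. y k + d * v k) - d * D \<le> barrier V u c y"
proof -
  let ?\<phi> = "\<lambda>t. barrier V u c (\<lambda>k. y k + t * v k)"
  obtain \<phi>' \<phi>'' where ph: "\<And>t. t > 0 \<Longrightarrow> (?\<phi> has_real_derivative \<phi>' t) (at t)"
    "\<And>t. t > 0 \<Longrightarrow> (\<phi>' has_real_derivative \<phi>'' t) (at t)"
    "\<And>t. t > 0 \<Longrightarrow> \<phi>' t \<le> 0" "\<And>t. t > 0 \<Longrightarrow> \<phi>'' t \<ge> 0"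
    using barrier_ray[OF fin st zf u v] by blast
  have D_eq: "D = \<phi>' d" using D ph(1)[OF d] by (rule DERIV_unique)
  then show "D \<le> 0" using ph(3) d by simp
  \<comment> \<open>\<open>barrier_ray\<close> covers only \<open>t > 0\<close>; at the endpoint
    \<open>0\<close> the mean value theorem needs no more than continuity.\<close>
  have cont: "continuous_on {0..d} ?\<phi>"
  proof (rule continuous_at_imp_continuous_on, rule ballI)
    fix t assume "t \<in> {0..d}"
    then have "mlin V c (\<lambda>k. y k + t * v k) \<noteq> 0"
      using v by (intro zero_free_aboveD[OF zf]) simp
    from barrier_ray_deriv[OF fin this] show "isCont ?\<phi> t" by (rule DERIV_isCont)
  qed
  obtain l z where z: "0 < z" "z < d" "(?\<phi> has_real_derivative l) (at z)"
    "?\<phi> d - ?\<phi> 0 = (d - 0) * l"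
    using MVT[OF d cont] ph(1) by (meson real_differentiable_def)
  have "\<phi>' z \<le> \<phi>' d"
  proof (rule DERIV_nonneg_imp_nondecreasing[of z d \<phi>'])
    fix x assume "z \<le> x" "x \<le> d"
    with z have "x > 0" by simp
    then show "\<exists>D. (\<phi>' has_real_derivative D) (at x) \<and> 0 \<le> D" using ph(2,4) by blast
  qed (use z in simp)
  moreover have "l = \<phi>' z" using z ph DERIV_unique by blast
  ultimately have "d * l \<le> d * D" using d D_eq by simp
  with z(4) show "?\<phi> d - d * D \<le> barrier V u c y" by simp
qed

text \<open>The point \<open>x\<close> has parameter \<open>1\<close> on the ray from
  \<open>y\<close> in direction \<open>x - y\<close>, and the slope there is at most
  \<open>0\<close>.\<close>

lemma barrier_antimono:
  fixes y :: "'k \<Rightarrow> real"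
  assumes fin: "finite V" and st: "stable V c" and zf: "zero_free_above V c y"
    and u: "\<forall>k\<in>V. u k \<ge> 0" and le: "\<forall>k\<in>V. y k \<le> x k"
  shows "barrier V u c x \<le> barrier V u c y"
proof -
  define v where "v = (\<lambda>k. x k - y k)"
  have v: "\<forall>k\<in>V. v k \<ge> 0" using le by (simp add: v_def)
  have x: "x = (\<lambda>k. y k + 1 * v k)" by (simp add: v_def)
  have "mlin V c (\<lambda>k. y k + 1 * v k) \<noteq> 0" using zf le by (simp add: zero_free_above_def v_def)
  from barrier_ray_tangent[OF fin st zf u v zero_less_one barrier_ray_deriv[OF fin this]]
  show ?thesis unfolding x[symmetric] by simp
qed

text \<open>Taking logarithmic derivatives of \<open>p - D\<^sub>v p = p (1 - D\<^sub>v p / p)\<close>.\<close>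

lemma barrier_one_minus_dd:
  fixes y :: "'k \<Rightarrow> real"
  assumes "finite V" "mlin V c x \<noteq> 0" "barrier V v c x < 1"
    and D: "((\<lambda>t. barrier V u c (\<lambda>k. y k + t * v k)) has_real_derivative D) (at d)"
    and x: "x = (\<lambda>k. y k + d * v k)"
  shows "barrier V u (one_minus_dd V v c) x = barrier V u c x - D / (1 - barrier V v c x)"
proof -
  let ?m = "\<lambda>c. mlin V c x"
  have D_eq: "D = (?m (dd V v (dd V u c)) * ?m c - ?m (dd V u c) * ?m (dd V v c)) / (?m c * ?m c)"
    using barrier_ray_deriv[of V c y d v u] assms DERIV_unique by blast
  have nz: "?m c - ?m (dd V v c) \<noteq> 0" using assms(2,3) by (auto simp: barrier_def)
  have "1 - barrier V v c x = (?m c - ?m (dd V v c)) / ?m c"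
    using assms(2) by (simp add: barrier_def field_simps)
  then show ?thesis
    unfolding D_eq barrier_def[of V u] dd_one_minus_dd mlin_one_minus_dd
    using nz assms(2) by (simp add: divide_simps) (simp add: algebra_simps)
qed

text \<open>Both factors of \<open>p - D_v p = p (1 - D_v p / p)\<close> are nonzero above
  \<open>y\<close>, the second because the barrier only decreases from a value below
  \<open>1\<close>.\<close>

lemma zero_free_above_one_minus_dd:
  fixes y :: "'k \<Rightarrow> real"
  assumes fin: "finite V" and st: "stable V c" and zf: "zero_free_above V c y"
    and v: "\<forall>k\<in>V. v k \<ge> 0" and less: "barrier V v c y < 1"
  shows "zero_free_above V (one_minus_dd V v c) y"
  unfolding zero_free_above_def
proof (intro allI impI)
  fix x assume le: "\<forall>k\<in>V. y k \<le> x k"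
  have "mlin V c x \<noteq> 0" using zf le by (simp add: zero_free_above_def)
  moreover have "barrier V v c x < 1"
    using barrier_antimono[OF fin st zf v le] less by linarith
  ultimately show "mlin V (one_minus_dd V v c) x \<noteq> 0"
    by (auto simp: mlin_one_minus_dd barrier_def)
qed

text \<open>With \<open>D\<close> the slope at the new point, the operator raises the barrier by
  \<open>- D / (1 - barrier V v c ?x)\<close>, at most \<open>- d * D\<close> by the assumed bound,
  while the move by \<open>d v\<close> lowers it by at least \<open>- d * D\<close> by
  convexity.\<close>

lemma barrier_shift:
  fixes y :: "'k \<Rightarrow> real"
  assumes fin: "finite V" and st: "stable V c" and zf: "zero_free_above V c y"
    and v: "\<forall>k\<in>V. v k \<ge> 0" and d: "d > 0" and le: "barrier V v c y \<le> 1 - 1 / d"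
  shows "zero_free_above V (one_minus_dd V v c) (\<lambda>k. y k + d * v k)"
    and "\<And>u. (\<forall>k\<in>V. u k \<ge> 0) \<Longrightarrow>
      barrier V u (one_minus_dd V v c) (\<lambda>k. y k + d * v k) \<le> barrier V u c y"
proof -
  let ?x = "\<lambda>k. y k + d * v k"
  have ge: "\<forall>k\<in>V. y k \<le> ?x k" using v d by simp
  have zfx: "zero_free_above V c ?x" using zf ge by (rule zero_free_above_mono)
  then have nz: "mlin V c ?x \<noteq> 0" by (rule zero_free_aboveD) simp
  have lex: "barrier V v c ?x \<le> 1 - 1 / d"
    using barrier_antimono[OF fin st zf v ge] le by linarith
  moreover have "1 / d > 0" using d by simp
  ultimately have less: "barrier V v c ?x < 1" by linarith
  show "zero_free_above V (one_minus_dd V v c) ?x"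
    by (rule zero_free_above_one_minus_dd[OF fin st zfx v less])
  fix u assume u: "\<forall>k\<in>V. (u k :: real) \<ge> 0"
  from barrier_ray_deriv[OF fin nz] obtain D where
    D: "((\<lambda>t. barrier V u c (\<lambda>k. y k + t * v k)) has_real_derivative D) (at d)" by blast
  note tan = barrier_ray_tangent[OF fin st zf u v d D]
  have "1 / (1 - barrier V v c ?x) \<le> d"
    using lex less d by (simp add: field_simps)
  then have "D * d \<le> D * (1 / (1 - barrier V v c ?x))"
    using tan(1) by (rule mult_left_mono_neg)
  then have "- D / (1 - barrier V v c ?x) \<le> - d * D" by (simp add: mult.commute)
  then show "barrier V u (one_minus_dd V v c) ?x \<le> barrier V u c y"
    using barrier_one_minus_dd[OF fin nz less D refl] tan(2) by simp
qed

text \<open>The change is \<open>- D / (1 - barrier V v c y)\<close>, where the slope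
  \<open>D\<close> along \<open>v\<close> is at most \<open>0\<close>. This is what makes neighbours
  in a chain exchangeable.\<close>

lemma barrier_le_barrier_one_minus_dd:
  fixes y :: "'k \<Rightarrow> real"
  assumes fin: "finite V" and st: "stable V c" and zf: "zero_free_above V c y"
    and u: "\<forall>k\<in>V. u k \<ge> 0" and v: "\<forall>k\<in>V. v k \<ge> 0" and less: "barrier V v c y < 1"
  shows "barrier V u c y \<le> barrier V u (one_minus_dd V v c) y"
proof -
  have nz: "mlin V c y \<noteq> 0" using zf by (rule zero_free_aboveD) simp
  then have "mlin V c (\<lambda>k. y k + 0 * v k) \<noteq> 0" by simp
  from barrier_ray_deriv[OF fin this] obtain D where
    D: "((\<lambda>t. barrier V u c (\<lambda>k. y k + t * v k)) has_real_derivative D) (at 0)" by blast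
  \<comment> \<open>Here \<open>y\<close> is the start of the ray, which \<open>barrier_ray\<close>
    does not cover, so the sign comes from monotonicity.\<close>
  have "D \<le> 0"
  proof (rule ccontr)
    assume "\<not> D \<le> 0"
    then obtain e where e: "e > 0"
      "\<forall>h>0. h < e \<longrightarrow> barrier V u c (\<lambda>k. y k + 0 * v k) < barrier V u c (\<lambda>k. y k + (0 + h) * v k)"
      using DERIV_pos_inc_right[OF D] by (auto simp: not_le)
    moreover have "barrier V u c (\<lambda>k. y k + e / 2 * v k) \<le> barrier V u c y"
      using v e by (intro barrier_antimono[OF fin st zf u]) simp
    ultimately show False using e(2)[rule_format, of "e / 2"] by simp
  qed
  then have "D / (1 - barrier V v c y) \<le> 0" using less by (simp add: divide_nonpos_pos)
  with barrier_one_minus_dd[OF fin nz less D] show ?thesis by simp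
qed

section \<open>Chains of operators and the choice of directions\<close>

lemma barrier_average:
  assumes "finite J" "J \<noteq> {}" "\<forall>k\<in>V. v k = (\<Sum>j\<in>J. w j k) / card J"
  shows "barrier V v c x = (\<Sum>j\<in>J. barrier V (w j) c x) / card J"
proof -
  have "mlin V (dd V v c) x = (\<Sum>k\<in>V. (\<Sum>j\<in>J. w j k) / card J * mlin V (pd k c) x)"
    unfolding mlin_dd using assms(3) by (intro sum.cong) auto
  also have "\<dots> = (\<Sum>j\<in>J. mlin V (dd V (w j) c) x) / card J"
    unfolding mlin_dd by (subst sum.swap) (simp add: sum_distrib_right sum_divide_distrib)
  finally show ?thesis
    by (simp add: barrier_def sum_divide_distrib divide_divide_eq_left mult.commute)
qed

text \<open>Unlike zero-freeness of \<open>fold (one_minus_dd V) vs c\<close> above \<open>y\<close>, the condition \<open>chain V y c vs\<close>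
  is inherited by prefixes of \<open>vs\<close>. It does not depend on the order of \<open>vs\<close>.\<close>

primrec chain :: "'k set \<Rightarrow> ('k \<Rightarrow> real) \<Rightarrow> ('k set \<Rightarrow> real) \<Rightarrow> ('k \<Rightarrow> real) list \<Rightarrow> bool" where
  "chain V y c [] \<longleftrightarrow> True"
| "chain V y c (v # vs) \<longleftrightarrow> barrier V v c y < 1 \<and> chain V y (one_minus_dd V v c) vs"

lemma chain_append:
  "chain V y c (vs @ ws) \<longleftrightarrow> chain V y c vs \<and> chain V y (fold (one_minus_dd V) vs c) ws"
  by (induction vs arbitrary: c) auto

lemma stable_fold:
  assumes "finite V" "stable V c" "\<forall>v\<in>set vs. \<forall>k\<in>V. v k \<ge> 0"
  shows "stable V (fold (one_minus_dd V) vs c)"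
  using assms(2,3)
  by (induction vs arbitrary: c) (simp_all add: stable_one_minus_dd[OF assms(1)])

lemma chain_zero_free:
  fixes y :: "'k \<Rightarrow> real"
  assumes "finite V" "stable V c" "zero_free_above V c y" "\<forall>v\<in>set vs. \<forall>k\<in>V. v k \<ge> 0"
    and "chain V y c vs"
  shows "zero_free_above V (fold (one_minus_dd V) vs c) y"
  using assms(2-)
  by (induction vs arbitrary: c)
     (simp_all add: stable_one_minus_dd[OF assms(1)] zero_free_above_one_minus_dd[OF assms(1)])

text \<open>The barrier of \<open>w\<close> can only have grown when \<open>v\<close> was applied,
  so it was below \<open>1\<close> before. In either order the two factors
  \<open>1 - barrier\<close> multiply to the ratio of the final to the initial value; the product is
  positive, hence so is the remaining factor.\<close>

lemma chain_swap:
  fixes y :: "'k \<Rightarrow> real"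
  assumes fin: "finite V" and st: "stable V c" and zf: "zero_free_above V c y"
    and v: "\<forall>k\<in>V. v k \<ge> 0" and w: "\<forall>k\<in>V. w k \<ge> 0"
    and ch: "chain V y c (v # w # vs)"
  shows "chain V y c (w # v # vs)"
proof -
  have bv: "barrier V v c y < 1" and bw: "barrier V w (one_minus_dd V v c) y < 1"
    using ch by auto
  have bw': "barrier V w c y < 1"
    using barrier_le_barrier_one_minus_dd[OF fin st zf w v bv] bw by linarith
  have factor: "mlin V (one_minus_dd V a c') y = mlin V c' y * (1 - barrier V a c' y)"
    if "mlin V c' y \<noteq> 0" for a c'
    using that by (simp add: mlin_one_minus_dd barrier_def field_simps)
  have nz: "mlin V c y \<noteq> 0" using zf by (rule zero_free_aboveD) simp
  have nzv: "mlin V (one_minus_dd V v c) y \<noteq> 0" "mlin V (one_minus_dd V w c) y \<noteq> 0"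
    using factor[OF nz] nz bv bw' by auto
  have "(1 - barrier V v c y) * (1 - barrier V w (one_minus_dd V v c) y)
      = (1 - barrier V w c y) * (1 - barrier V v (one_minus_dd V w c) y)"
  proof -
    have "mlin V (one_minus_dd V w (one_minus_dd V v c)) y
        = mlin V (one_minus_dd V v (one_minus_dd V w c)) y"
      by (simp add: one_minus_dd_commute)
    then show ?thesis using nz unfolding factor[OF nzv(1)] factor[OF nzv(2)] factor[OF nz] by simp
  qed
  moreover have "(1 - barrier V v c y) * (1 - barrier V w (one_minus_dd V v c) y) > 0"
    using bv bw by simp
  ultimately have "barrier V v (one_minus_dd V w c) y < 1"
    using bw' by (simp add: zero_less_mult_iff)
  with bw' ch show ?thesis by (simp add: one_minus_dd_commute)
qed

text \<open>Repeated exchange of neighbours. At the end of the list a direction can be replaced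
  without affecting the conditions on the others.\<close>

lemma chain_rotate:
  fixes y :: "'k \<Rightarrow> real"
  assumes fin: "finite V" and "stable V c" "zero_free_above V c y"
    and v: "\<forall>k\<in>V. v k \<ge> 0" and "\<forall>w\<in>set vs. \<forall>k\<in>V. w k \<ge> 0"
    and "chain V y c (v # vs)"
  shows "chain V y c (vs @ [v])"
  using assms(2,3,5,6)
proof (induction vs arbitrary: c)
  case (Cons w vs)
  then have w: "\<forall>k\<in>V. w k \<ge> 0" by simp
  have *: "chain V y c (w # v # vs)"
    by (rule chain_swap[OF fin Cons.prems(1,2) v w Cons.prems(4)])
  then have "chain V y (one_minus_dd V w c) (vs @ [v])"
    using Cons.prems w
    by (intro Cons.IH) (auto intro: stable_one_minus_dd[OF fin] zero_free_above_one_minus_dd[OF fin])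
  with * show ?case by simp
qed simp

text \<open>The barrier in direction \<open>v\<close> is the mean of those in the directions
  \<open>w j\<close>; a mean below \<open>1\<close> has a member below \<open>1\<close>.\<close>

lemma chain_replace_last:
  assumes "chain V y c (vs @ [v])"
    and J: "finite J" "J \<noteq> {}" "\<forall>k\<in>V. v k = (\<Sum>j\<in>J. w j k) / card J"
  shows "\<exists>j\<in>J. chain V y c (vs @ [w j])"
proof (rule ccontr)
  define c' where "c' = fold (one_minus_dd V) vs c"
  assume "\<not> ?thesis"
  then have "\<forall>j\<in>J. 1 \<le> barrier V (w j) c' y"
    using assms(1) by (auto simp: chain_append c'_def not_less)
  then have "(\<Sum>j\<in>J. 1) \<le> (\<Sum>j\<in>J. barrier V (w j) c' y)"
    by (intro sum_mono) auto
  then have "1 \<le> barrier V v c' y"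
    unfolding barrier_average[OF J] using J by (simp add: le_divide_eq card_gt_0_iff)
  with assms(1) show False by (simp add: chain_append c'_def)
qed

lemma chain_of_barrier_bound:
  fixes y :: "'k \<Rightarrow> real"
  assumes fin: "finite V" and st: "stable V c" and zf: "zero_free_above V c y"
    and d: "d > 0" and u: "\<And>i. i < n \<Longrightarrow> \<forall>k\<in>V. u i k \<ge> 0"
    and bar: "\<And>i. i < n \<Longrightarrow> barrier V (u i) c y \<le> 1 - 1 / d"
  shows "chain V (\<lambda>k. y k + d * (\<Sum>i<n. u i k)) c (map u [0..<n])"
proof -
  let ?c = "\<lambda>m. fold (one_minus_dd V) (map u [0..<m]) c"
  let ?y = "\<lambda>m k. y k + d * (\<Sum>i<m. u i k)"
  \<comment> \<open>The first two conjuncts follow the moving point \<open>?y m\<close>, while the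
    chain is stated at the final point \<open>?y n\<close>; barriers decrease on the way
    there.\<close>
  have "zero_free_above V (?c m) (?y m) \<and> (\<forall>i<n. barrier V (u i) (?c m) (?y m) \<le> 1 - 1 / d)
      \<and> chain V (?y n) c (map u [0..<m])" if "m \<le> n" for m
    using that
  proof (induction m)
    case 0
    then show ?case using zf bar by simp
  next
    case (Suc m)
    then have IH: "zero_free_above V (?c m) (?y m)" "\<forall>i<n. barrier V (u i) (?c m) (?y m) \<le> 1 - 1 / d"
      "chain V (?y n) c (map u [0..<m])" and m: "m < n" by auto
    have st': "stable V (?c m)"
      using u m by (intro stable_fold[OF fin st]) auto
    have y_Suc: "?y (Suc m) = (\<lambda>k. ?y m k + d * u m k)"
      by (rule ext) (simp add: algebra_simps)
    have le: "\<forall>k\<in>V. ?y m k \<le> ?y n k"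
    proof
      fix k assume "k \<in> V"
      then have "(\<Sum>i<m. u i k) \<le> (\<Sum>i<n. u i k)"
        using u m by (intro sum_mono2) auto
      then show "?y m k \<le> ?y n k" using d by simp
    qed
    have "barrier V (u m) (?c m) (?y n) \<le> barrier V (u m) (?c m) (?y m)"
      using le by (rule barrier_antimono[OF fin st' IH(1) u[OF m]])
    also have "\<dots> \<le> 1 - 1 / d" using IH(2) m by blast
    also have "\<dots> < 1" using d by simp
    finally have less: "barrier V (u m) (?c m) (?y n) < 1" .
    note shift = barrier_shift[OF fin st' IH(1) u[OF m] d IH(2)[rule_format, OF m]]
    have "barrier V (u i) (?c (Suc m)) (?y (Suc m)) \<le> 1 - 1 / d" if "i < n" for i
      using order_trans[OF shift(2)[OF u[OF that]] IH(2)[rule_format, OF that]]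
      unfolding y_Suc by simp
    moreover have "zero_free_above V (?c (Suc m)) (?y (Suc m))"
      using shift(1) unfolding y_Suc by simp
    ultimately show ?case
      using IH(3) less by (simp add: chain_append)
  qed
  then show ?thesis by blast
qed

lemma zero_free_selection:
  fixes y :: "'k \<Rightarrow> real" and n r :: nat
  assumes fin: "finite V" and st: "stable V c" and zf: "zero_free_above V c y"
    and d: "d > 0" and w: "\<And>i j. i < n \<Longrightarrow> j < r \<Longrightarrow> \<forall>k\<in>V. w i j k \<ge> 0" and r: "r > 0"
    and u: "\<And>i k. u i k = (\<Sum>j<r. w i j k) / r"
    and bar: "\<And>i. i < n \<Longrightarrow> barrier V (u i) c y \<le> 1 - 1 / d"
  shows "\<exists>f. (\<forall>i<n. f i < r) \<and> zero_free_above V (fold (one_minus_dd V) (map (\<lambda>i. w i (f i)) [0..<n]) c)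
           (\<lambda>k. y k + d * (\<Sum>i<n. u i k))"
proof -
  let ?y = "\<lambda>k. y k + d * (\<Sum>i<n. u i k)"
  have u_nonneg: "\<forall>k\<in>V. u i k \<ge> 0" if "i < n" for i
    unfolding u using w[OF that] by (auto intro!: divide_nonneg_nonneg sum_nonneg)
  have zfy: "zero_free_above V c ?y"
  proof (rule zero_free_above_mono[OF zf], rule ballI)
    fix k assume "k \<in> V"
    then have "(\<Sum>i<n. u i k) \<ge> 0" using u_nonneg by (auto intro!: sum_nonneg)
    then show "y k \<le> ?y k" using d by simp
  qed
  \<comment> \<open>Invariant: the averages with index at least \<open>m\<close> come first, the
    choices already made come last. Rotating \<open>u m\<close> to the end makes it
    replaceable.\<close>
  have "\<exists>f. (\<forall>i<m. f i < r) \<and> chain V ?y c (map u [m..<n] @ map (\<lambda>i. w i (f i)) [0..<m])"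
    if "m \<le> n" for m
    using that
  proof (induction m)
    case 0
    then show ?case using chain_of_barrier_bound[OF fin st zf d u_nonneg bar] by simp
  next
    case (Suc m)
    then obtain f where f: "\<forall>i<m. f i < r"
      "chain V ?y c (map u [m..<n] @ map (\<lambda>i. w i (f i)) [0..<m])" and m: "m < n" by auto
    define vs where "vs = map u [Suc m..<n] @ map (\<lambda>i. w i (f i)) [0..<m]"
    have "chain V ?y c (u m # vs)"
      using f(2) m by (simp add: vs_def upt_conv_Cons)
    then have "chain V ?y c (vs @ [u m])"
      using m u_nonneg w f(1) by (intro chain_rotate[OF fin st zfy]) (auto simp: vs_def)
    then obtain j where j: "j < r" "chain V ?y c (vs @ [w m j])"
      using chain_replace_last[of V ?y c vs "u m" "{..<r}" "w m"] u r by auto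
    define f' where "f' = f(m := j)"
    have eq: "map (\<lambda>i. w i (f' i)) [0..<Suc m] = map (\<lambda>i. w i (f i)) [0..<m] @ [w m j]"
      by (simp add: f'_def)
    have "chain V ?y c (map u [Suc m..<n] @ map (\<lambda>i. w i (f' i)) [0..<Suc m])"
      using j(2) unfolding vs_def eq by simp
    moreover have "\<forall>i<Suc m. f' i < r" using f(1) j(1) by (simp add: f'_def less_Suc_eq)
    ultimately show ?case by blast
  qed
  from this[of n] obtain f where f: "\<forall>i<n. f i < r" "chain V ?y c (map (\<lambda>i. w i (f i)) [0..<n])"
    by auto
  then have "zero_free_above V (fold (one_minus_dd V) (map (\<lambda>i. w i (f i)) [0..<n]) c) ?y"
    using w by (intro chain_zero_free[OF fin st zfy]) auto
  with f(1) show ?thesis by blast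
qed

section \<open>Determinants and eigenvalues\<close>

lemma det_row_add_multiple:
  fixes a :: "'d::finite \<Rightarrow> 'a::comm_ring_1^'d"
  assumes "finite T" "k \<notin> T"
  shows "det (\<chi> j. if j = k then v else if j \<in> T then a j + c j *s v else a j)
       = det (\<chi> j. if j = k then v else a j)"
  using assms
proof (induction T rule: finite_induct)
  case (insert l T)
  let ?b = "\<lambda>j. if j = k then v else if j \<in> T then a j + c j *s v else a j"
  have "(\<chi> j. if j = k then v else if j \<in> insert l T then a j + c j *s v else a j)
      = (\<chi> j. if j = l then a j + c j *s v else ?b j)"
    using insert by (auto simp: vec_eq_iff)
  moreover have "det (\<chi> j. if j = l then c j *s v else ?b j) = c l * det (\<chi> j. if j = l then v else ?b j)"
    using det_row_mul[of l "c l" "\<lambda>_. v" ?b] by (simp cong: if_cong)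
  moreover have "det (\<chi> j. if j = l then v else ?b j) = 0"
    using insert by (intro det_identical_rows[of l k]) (auto simp: row_def vec_eq_iff)
  moreover have "(\<chi> j. if j = l then a j else ?b j) = (\<chi> j. ?b j)"
    using insert by (auto simp: vec_eq_iff)
  ultimately show ?case using insert by (simp add: det_row_add)
qed (simp cong: if_cong)

text \<open>Multilinearity in the rows: once one row is \<open>v\<close>, row operations erase all
  other multiples of \<open>v\<close>, so no power of \<open>s\<close> beyond the first
  survives.\<close>

lemma det_rank_one_affine:
  fixes a :: "'d::finite \<Rightarrow> 'a::comm_ring_1^'d"
  assumes "finite T"
  shows "det (\<chi> j. if j \<in> T then a j + (s * c j) *s v else a j)
       = det (\<chi> j. a j) + s * (\<Sum>k\<in>T. c k * det (\<chi> j. if j = k then v else a j))"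
  using assms
proof (induction T rule: finite_induct)
  case (insert l T)
  let ?b = "\<lambda>j. if j \<in> T then a j + (s * c j) *s v else a j"
  have "(\<chi> j. if j \<in> insert l T then a j + (s * c j) *s v else a j)
      = (\<chi> j. if j = l then a j + (s * c j) *s v else ?b j)"
    using insert by (auto simp: vec_eq_iff)
  moreover have "det (\<chi> j. if j = l then (s * c j) *s v else ?b j)
      = s * c l * det (\<chi> j. if j = l then v else ?b j)"
    using det_row_mul[of l "s * c l" "\<lambda>_. v" ?b] by (simp cong: if_cong)
  moreover have "det (\<chi> j. if j = l then v else ?b j) = det (\<chi> j. if j = l then v else a j)"
    using insert by (intro det_row_add_multiple)
  moreover have "(\<chi> j. if j = l then a j else ?b j) = (\<chi> j. ?b j)"
    using insert by (auto simp: vec_eq_iff)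
  ultimately show ?case using insert by (simp add: det_row_add algebra_simps)
qed simp

lemma det_eq_0_iff_kernel:
  fixes A :: "'a::field^'d^'d"
  shows "det A = 0 \<longleftrightarrow> (\<exists>x. x \<noteq> 0 \<and> A *v x = 0)"
  using invertible_det_nz[of A] invertible_left_inverse[of A] matrix_left_invertible_ker[of A] by auto

lemma cnj_det: "cnj (det A) = det (\<chi> i j. cnj (A $ i $ j))"
  by (simp add: det_def)

section \<open>An eigenvector that attains the operator norm\<close>

lemma linear_coeff_eq_0:
  fixes a b :: real
  assumes "\<And>t. 0 \<le> a * t + b * t\<^sup>2"
  shows "a = 0"
proof (rule ccontr)
  assume "a \<noteq> 0"
  \<comment> \<open>Since \<open>m > b\<close>, the point \<open>- a / m\<close> gives the negative
    value \<open>a\<^sup>2 / m\<^sup>2 * (b - m)\<close>.\<close>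
  define m where "m = \<bar>b\<bar> + 1"
  have m: "m > 0" "b < m" by (auto simp: m_def)
  have "a * (- a / m) + b * (- a / m)\<^sup>2 = a\<^sup>2 / m\<^sup>2 * (b - m)"
    using m by (simp add: field_simps power2_eq_square)
  moreover have "\<dots> < 0" using m \<open>a \<noteq> 0\<close> by (intro mult_pos_neg) auto
  ultimately show False using assms[of "- a / m"] by linarith
qed

text \<open>At a maximiser \<open>x\<close> of \<open>norm (f x)\<close> on the unit sphere,
  stationarity gives \<open>f (f x) = m\<^sup>2 x\<close>. Then \<open>f x + m x\<close> is an
  eigenvector for \<open>m\<close>, or it vanishes and positivity forces
  \<open>m = 0\<close>.\<close>

lemma onorm_eigenvector:
  fixes f :: "'a::euclidean_space \<Rightarrow> 'a"
  assumes lin: "linear f" and adj: "\<And>x y. f x \<bullet> y = x \<bullet> f y" and nonneg: "\<And>x. x \<bullet> f x \<ge> 0"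
  shows "\<exists>x. x \<noteq> 0 \<and> f x = onorm f *\<^sub>R x"
proof -
  interpret f: linear f by fact
  have bl: "bounded_linear f" using lin by (simp add: linear_conv_bounded_linear)
  have "continuous_on (sphere 0 1) (\<lambda>x. norm (f x))"
    by (intro continuous_intros linear_continuous_on[OF bl])
  moreover have "sphere (0::'a) 1 \<noteq> {}"
    using norm_Basis SOME_Basis by (metis empty_iff mem_sphere_0)
  ultimately obtain x where x: "norm x = 1" and max: "\<And>y. norm y = 1 \<Longrightarrow> norm (f y) \<le> norm (f x)"
    using continuous_attains_sup[OF compact_sphere] by (metis mem_sphere_0)
  define m where "m = norm (f x)"
  have le: "norm (f y) \<le> m * norm y" for y
  proof (cases "y = 0")
    case False
    then have "norm (f ((1 / norm y) *\<^sub>R y)) \<le> m" unfolding m_def by (intro max) simp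
    with False show ?thesis by (simp add: f.scaleR field_simps)
  qed (simp add: f.zero)
  have m: "onorm f = m"
  proof (rule antisym)
    show "onorm f \<le> m" using le by (rule onorm_le)
    show "m \<le> onorm f" using onorm[OF bl, of x] x by (simp add: m_def)
  qed
  have crit: "m\<^sup>2 *\<^sub>R x = f (f x)"
  proof -
    have "(m\<^sup>2 *\<^sub>R x - f (f x)) \<bullet> y = 0" for y
    proof -
      \<comment> \<open>The defect of the squared inequality
        \<open>norm (f z) \<le> m * norm z\<close> at \<open>z = x + t y\<close> is a nonnegative
        quadratic in \<open>t\<close> vanishing at \<open>0\<close>, so its linear coefficient is
        zero.\<close>
      have "2 * ((m\<^sup>2 *\<^sub>R x - f (f x)) \<bullet> y) = 0"
      proof (rule linear_coeff_eq_0)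
        fix t :: real
        have "(norm (f (x + t *\<^sub>R y)))\<^sup>2 \<le> (m * norm (x + t *\<^sub>R y))\<^sup>2"
          by (intro power_mono le) simp
        then have "0 \<le> m\<^sup>2 * ((x + t *\<^sub>R y) \<bullet> (x + t *\<^sub>R y)) - f (x + t *\<^sub>R y) \<bullet> f (x + t *\<^sub>R y)"
          by (simp add: power_mult_distrib power2_norm_eq_inner)
        also have "\<dots> = (m\<^sup>2 * (x \<bullet> x) - f x \<bullet> f x) + 2 * ((m\<^sup>2 *\<^sub>R x - f (f x)) \<bullet> y) * t
            + (m\<^sup>2 * (y \<bullet> y) - f y \<bullet> f y) * t\<^sup>2"
          using adj[of "f x" y]
          by (simp add: f.add f.scaleR inner_simps inner_commute algebra_simps power2_eq_square)
        also have "m\<^sup>2 * (x \<bullet> x) - f x \<bullet> f x = 0"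
          using x by (simp add: m_def power2_norm_eq_inner[symmetric])
        finally show "0 \<le> 2 * ((m\<^sup>2 *\<^sub>R x - f (f x)) \<bullet> y) * t + (m\<^sup>2 * (y \<bullet> y) - f y \<bullet> f y) * t\<^sup>2"
          by simp
      qed
      then show ?thesis by simp
    qed
    from this[of "m\<^sup>2 *\<^sub>R x - f (f x)"] show ?thesis by simp
  qed
  show ?thesis
  proof (cases "f x + m *\<^sub>R x = 0")
    case True
    then have "f x = - m *\<^sub>R x" by (simp add: eq_neg_iff_add_eq_0)
    then have "- m \<ge> 0" using nonneg[of x] x by (simp add: power2_norm_eq_inner[symmetric])
    then have "m = 0" unfolding m_def by (metis neg_0_le_iff_le norm_le_zero_iff norm_zero)
    then show ?thesis using x m m_def by (intro exI[of _ x]) auto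
  next
    case False
    have "f (f x + m *\<^sub>R x) = m *\<^sub>R (f x + m *\<^sub>R x)"
      by (simp add: f.add f.scaleR crit[symmetric] algebra_simps power2_eq_square)
    with False m show ?thesis by blast
  qed
qed

section \<open>Complex combinations of matrices and the Hermitian form\<close>

definition mcomb :: "nat \<Rightarrow> (nat \<Rightarrow> complex^'d^'d) \<Rightarrow> (nat \<Rightarrow> complex) \<Rightarrow> complex^'d^'d" where
  "mcomb n M z = (\<chi> a b. \<Sum>i<n. z i * M i $ a $ b)"

lemma mcomb_mult: "mcomb n M z *v x = (\<Sum>i<n. z i *s (M i *v x))"
  by (simp add: mcomb_def vec_eq_iff matrix_vector_mult_def sum_distrib_right sum_distrib_left mult.assoc)
     (simp add: sum.swap[of _ UNIV])

lemma sum_matrix_vector_mult: "(\<Sum>i\<in>A. M i) *v x = (\<Sum>i\<in>A. M i *v (x :: 'a::comm_ring_1^'d))"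
  by (induction A rule: infinite_finite_induct) (simp_all add: matrix_vector_mult_add_rdistrib)

lemma cinner_vec_sum_smult:
  "cinner_vec x (\<Sum>i\<in>A. z i *s y i) = (\<Sum>i\<in>A. z i * cinner_vec x (y i))"
  by (simp add: cinner_vec_def sum_distrib_left mult_ac) (rule sum.swap)

lemma cinner_vec_self: "cinner_vec x x = of_real ((norm x)\<^sup>2)"
  by (simp add: cinner_vec_def norm_vec_def L2_set_def sum_nonneg complex_norm_square mult.commute
      del: of_real_power)

lemma inner_eq_Re_cinner: "x \<bullet> y = Re (cinner_vec x y)"
  by (simp add: inner_vec_def cinner_vec_def inner_complex_def)

lemma cinner_vec_commute: "cinner_vec x y = cnj (cinner_vec y x)"
  by (simp add: cinner_vec_def mult.commute)

lemma scaleR_eq_smult: "c *\<^sub>R x = of_real c *s (x :: complex^'d)"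
  unfolding vec_eq_iff vector_scaleR_component vector_smult_component by (simp add: scaleR_conv_of_real)

lemma matrix_vector_mult_axis_nth: "(B *v axis a 1) $ b = B $ b $ (a :: 'd::finite)"
  for B :: "complex^'d^'d"
  by (simp add: matrix_vector_mult_def axis_def if_distrib cong: if_cong)

section \<open>Rank-one measurements\<close>

locale rank_one_povm =
  fixes M :: "nat \<Rightarrow> complex^'d^'d" and \<psi> :: "nat \<Rightarrow> complex^'d" and \<alpha> :: "nat \<Rightarrow> real"
    and n :: nat
  assumes povm: "is_POVM M n"
    and rank1: "\<And>i. i < n \<Longrightarrow> M i = \<alpha> i *\<^sub>R ketbra (\<psi> i)"
    and unit: "\<And>i. i < n \<Longrightarrow> norm (\<psi> i) = 1"
    and pos: "\<And>i. i < n \<Longrightarrow> \<alpha> i > 0"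
begin

lemma M_nth: "i < n \<Longrightarrow> M i $ a $ b = of_real (\<alpha> i) * (\<psi> i $ a * cnj (\<psi> i $ b))"
  by (simp add: rank1 ketbra_def) (simp add: scaleR_conv_of_real)

lemma M_mult: "i < n \<Longrightarrow> M i *v x = (of_real (\<alpha> i) * cinner_vec (\<psi> i) x) *s \<psi> i"
  by (simp add: vec_eq_iff matrix_vector_mult_def M_nth cinner_vec_def sum_distrib_left mult_ac)

lemma sum_M: "(\<Sum>i<n. M i) = mat 1"
  using povm by (simp add: is_POVM_def)

text \<open>A kernel vector \<open>x\<close> makes the sum of \<open>z i * q i\<close> vanish. After
  rotation by \<open>\<omega>\<close> all weights have positive real part, so every
  \<open>q i\<close> is \<open>0\<close>, yet they sum to the squared norm of \<open>x\<close>.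
  Stability uses \<open>\<omega> = - \<i>\<close>, positive real points use
  \<open>\<omega> = 1\<close>.\<close>

lemma det_mcomb_nonzero:
  assumes "\<And>i. i < n \<Longrightarrow> Re (\<omega> * z i) > 0"
  shows "det (mcomb n M z) \<noteq> 0"
proof
  assume "det (mcomb n M z) = 0"
  then obtain x where x: "x \<noteq> 0" "mcomb n M z *v x = 0" using det_eq_0_iff_kernel by blast
  define q where "q = (\<lambda>i. Re (cinner_vec x (M i *v x)))"
  have q: "cinner_vec x (M i *v x) = of_real (q i)" "q i \<ge> 0" if "i < n" for i
    using povm that by (auto simp: is_POVM_def psd_def q_def complex_eq_iff)
  have "(\<Sum>i<n. z i * of_real (q i)) = cinner_vec x (mcomb n M z *v x)"
    by (simp add: mcomb_mult cinner_vec_sum_smult q)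
  also have "\<dots> = 0" by (simp add: x cinner_vec_def)
  finally have "Re (\<omega> * (\<Sum>i<n. z i * of_real (q i))) = 0" by simp
  then have "(\<Sum>i<n. Re (\<omega> * z i) * q i) = 0"
    by (simp add: sum_distrib_left mult.assoc[symmetric])
  then have "\<forall>i\<in>{..<n}. Re (\<omega> * z i) * q i = 0"
    using assms q(2) by (subst (asm) sum_nonneg_eq_0_iff)
      (auto simp del: times_complex.sel intro!: mult_nonneg_nonneg intro: less_imp_le)
  then have q0: "q i = 0" if "i < n" for i
    using assms[OF that] that by (metis lessThan_iff less_irrefl mult_eq_0_iff)
  have "cinner_vec x ((\<Sum>i<n. M i) *v x) = (\<Sum>i<n. of_real (q i))"
    using cinner_vec_sum_smult[of x "\<lambda>_. 1" "\<lambda>i. M i *v x" "{..<n}"]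
    by (simp add: sum_matrix_vector_mult q)
  then have "cinner_vec x x = 0" by (simp add: sum_M q0)
  then show False using x by (simp add: cinner_vec_self)
qed

lemma det_mcomb_affine:
  assumes i: "i < n"
  shows "\<exists>K. \<forall>s. det (mcomb n M (z(i := s))) = det (mcomb n M (z(i := 0))) + s * K"
proof -
  define B where "B = mcomb n M (z(i := 0))"
  define v where "v = (\<chi> b. cnj (\<psi> i $ b))"
  define c where "c = (\<lambda>a. of_real (\<alpha> i) * \<psi> i $ a)"
  have "mcomb n M (z(i := s)) = (\<chi> a. if a \<in> UNIV then B $ a + (s * c a) *s v else B $ a)" for s
  proof -
    have "(\<Sum>j<n. (z(i := s)) j * M j $ a $ b) = (\<Sum>j<n. (z(i := 0)) j * M j $ a $ b) + s * M i $ a $ b"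
      for a b
      using i by (simp add: sum.remove[of "{..<n}" i])
    then show ?thesis
      using i by (simp add: mcomb_def B_def v_def c_def vec_eq_iff M_nth mult_ac)
  qed
  then have "det (mcomb n M (z(i := s)))
     = det B + s * (\<Sum>k\<in>UNIV. c k * det (\<chi> j. if j = k then v else B $ j))" for s
    using det_rank_one_affine[OF finite_class.finite_UNIV, of "\<lambda>a. B $ a" s c v] by simp
  then show ?thesis unfolding B_def by blast
qed

text \<open>For real weights the matrix is Hermitian: conjugating its entries transposes it and so
  keeps the determinant.\<close>

lemma det_mcomb_real: "det (mcomb n M (\<lambda>i. of_real (x i))) \<in> \<real>"
proof -
  let ?B = "mcomb n M (\<lambda>i. of_real (x i))"
  have "(\<chi> a b. cnj (?B $ a $ b)) = transpose ?B"
    by (simp add: vec_eq_iff transpose_def mcomb_def M_nth mult_ac)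
  then have "cnj (det ?B) = det ?B" by (simp add: cnj_det)
  then show ?thesis by (simp add: Reals_cnj_iff)
qed

lemma mcomb_const: "mcomb n M (\<lambda>_. t) *v x = t *s x"
proof -
  have "mcomb n M (\<lambda>_. t) *v x = t *s ((\<Sum>i<n. M i) *v x)"
    by (simp add: mcomb_mult sum_matrix_vector_mult vec.scale_sum_right)
  then show ?thesis by (simp add: sum_M)
qed

text \<open>An affine function is determined by its value at \<open>t\<close> and one zero. The
  result is the logarithmic derivative \<open>\<alpha> i / t\<close> at the constant point
  \<open>t\<close>.\<close>

lemma det_mcomb_step:
  assumes i: "i < n" and t: "t > 0"
  shows "det (mcomb n M ((\<lambda>_. of_real t)(i := of_real t + 1)))
       = of_real (1 + \<alpha> i / t) * det (mcomb n M (\<lambda>_. of_real t))"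
proof -
  obtain D K where DK: "\<And>s. det (mcomb n M ((\<lambda>_. of_real t)(i := s))) = D + s * K"
    using det_mcomb_affine[OF i] by metis
  have ai: "\<alpha> i > 0" using pos i .
  \<comment> \<open>At this weight the matrix is \<open>t I - (t / \<alpha> i) M i\<close>, which
    kills \<open>\<psi> i\<close>.\<close>
  define s where "s = complex_of_real t - of_real (t / \<alpha> i)"
  have "mcomb n M ((\<lambda>_. of_real t)(i := s)) *v \<psi> i = 0"
  proof -
    have "mcomb n M ((\<lambda>_. of_real t)(i := s)) *v \<psi> i
        = mcomb n M (\<lambda>_. of_real t) *v \<psi> i - of_real (t / \<alpha> i) *s (M i *v \<psi> i)"
      unfolding mcomb_mult using i
      by (simp add: sum.remove[of "{..<n}" i] s_def vec.scale_left_diff_distrib)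
    also have "M i *v \<psi> i = of_real (\<alpha> i) *s \<psi> i"
      using i by (simp add: M_mult cinner_vec_self unit)
    also have "mcomb n M (\<lambda>_. of_real t) *v \<psi> i - of_real (t / \<alpha> i) *s (of_real (\<alpha> i) *s \<psi> i) = 0"
      using ai by (simp add: mcomb_const vec.scale_scale)
    finally show ?thesis .
  qed
  moreover have "\<psi> i \<noteq> 0" using unit[OF i] by auto
  ultimately have "D + s * K = 0" using DK det_eq_0_iff_kernel by metis
  moreover have Q: "det (mcomb n M (\<lambda>_. of_real t)) = D + of_real t * K"
    using DK[of "of_real t"] by (simp add: fun_upd_idem)
  ultimately have "K * of_real t = of_real (\<alpha> i) * det (mcomb n M (\<lambda>_. of_real t))"
    using ai by (simp add: s_def field_simps)
  then have K: "K = of_real (\<alpha> i / t) * det (mcomb n M (\<lambda>_. of_real t))"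
    using t by (simp add: field_simps)
  have "det (mcomb n M ((\<lambda>_. of_real t)(i := of_real t + 1))) = (D + of_real t * K) + K"
    unfolding DK by (simp add: algebra_simps)
  also have "\<dots> = det (mcomb n M (\<lambda>_. of_real t)) + of_real (\<alpha> i / t) * det (mcomb n M (\<lambda>_. of_real t))"
    by (simp only: Q[symmetric] K[symmetric])
  finally show ?thesis by (simp only: of_real_add of_real_1 distrib_right mult_1)
qed

text \<open>The matrix in the hypothesis is \<open>X I\<close> minus \<open>r\<close> times the
  block sum. For \<open>X = r * op_norm (\<Sum>i\<in>A. M i)\<close> it kills the eigenvector
  attaining the norm, so this \<open>X\<close> lies below \<open>l\<close>.\<close>

lemma op_norm_less:
  assumes A: "A \<subseteq> {..<n}"
    and det: "\<And>X. X \<ge> l \<Longrightarrow> det (mcomb n M (\<lambda>i. of_real (if i \<in> A then X - r else X))) \<noteq> 0"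
  shows "r * op_norm (\<Sum>i\<in>A. M i) < l"
proof (rule ccontr)
  let ?f = "\<lambda>x. (\<Sum>i\<in>A. M i) *v x"
  assume "\<not> ?thesis"
  then have X: "r * op_norm (\<Sum>i\<in>A. M i) \<ge> l" by simp
  define X where "X = r * op_norm (\<Sum>i\<in>A. M i)"
  have f: "x \<bullet> ?f y = (\<Sum>i\<in>A. \<alpha> i * Re (cinner_vec x (\<psi> i) * cinner_vec (\<psi> i) y))" for x y
  proof -
    have "cinner_vec x (?f y) = (\<Sum>i\<in>A. (of_real (\<alpha> i) * cinner_vec (\<psi> i) y) * cinner_vec x (\<psi> i))"
      unfolding sum_matrix_vector_mult cinner_vec_sum_smult[symmetric]
      using A by (intro arg_cong[where f = "cinner_vec x"] sum.cong) (auto simp: M_mult)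
    then show ?thesis
      by (auto simp: inner_eq_Re_cinner algebra_simps intro!: sum.cong)
  qed
  have "\<exists>x. x \<noteq> 0 \<and> ?f x = onorm ?f *\<^sub>R x"
  proof (rule onorm_eigenvector)
    show "linear ?f" by simp
    show "?f x \<bullet> y = x \<bullet> ?f y" for x y
    proof -
      have "Re (cinner_vec y (\<psi> i) * cinner_vec (\<psi> i) x) = Re (cinner_vec x (\<psi> i) * cinner_vec (\<psi> i) y)" for i
        unfolding cinner_vec_commute[of y "\<psi> i"] cinner_vec_commute[of x "\<psi> i"] by simp
      then show ?thesis unfolding inner_commute[of "?f x"] f by simp
    qed
    show "x \<bullet> ?f x \<ge> 0" for x
      unfolding f using A pos
      by (intro sum_nonneg mult_nonneg_nonneg) (auto simp: cinner_vec_commute[of x] less_imp_le)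
  qed
  then obtain x where x: "x \<noteq> 0" "?f x = of_real (op_norm (\<Sum>i\<in>A. M i)) *s x"
    unfolding op_norm_def scaleR_eq_smult by blast
  have "mcomb n M (\<lambda>i. of_real (if i \<in> A then X - r else X)) *v x
      = mcomb n M (\<lambda>_. of_real X) *v x - of_real r *s ?f x"
  proof -
    have "(\<Sum>i<n. (if i \<in> A then of_real r *s (M i *v x) else 0)) = (\<Sum>i\<in>A. of_real r *s (M i *v x))"
      using A by (subst sum.inter_restrict[symmetric]) (auto simp: Int_absorb1)
    moreover have "of_real (if i \<in> A then X - r else X) *s (M i *v x)
        = of_real X *s (M i *v x) - (if i \<in> A then of_real r *s (M i *v x) else 0)" for i
      by (simp add: vec.scale_left_diff_distrib)
    ultimately show ?thesis
      by (simp only: mcomb_mult sum_subtractf sum_matrix_vector_mult vec.scale_sum_right)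
  qed
  also have "\<dots> = 0"
    by (simp add: mcomb_const x(2) X_def vec.scale_scale)
  finally have "det (mcomb n M (\<lambda>i. of_real (if i \<in> A then X - r else X))) = 0"
    using x(1) det_eq_0_iff_kernel by blast
  with det X show False by (simp add: X_def)
qed

text \<open>The weights sum to the trace of the block sum, and each diagonal entry has real part at
  most the operator norm.\<close>

lemma sum_weights_le:
  assumes A: "A \<subseteq> {..<n}"
  shows "(\<Sum>i\<in>A. \<alpha> i) \<le> CARD('d) * op_norm (\<Sum>i\<in>A. M i)"
proof -
  let ?B = "\<Sum>i\<in>A. M i"
  have bl: "bounded_linear (\<lambda>x. ?B *v x)" by (simp add: linear_conv_bounded_linear[symmetric])
  have "(\<Sum>i\<in>A. \<alpha> i) = (\<Sum>i\<in>A. \<Sum>a\<in>UNIV. Re (M i $ a $ a))"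
  proof (rule sum.cong[OF refl])
    fix i assume "i \<in> A"
    then have i: "i < n" using A by auto
    have "(\<Sum>a\<in>UNIV. M i $ a $ a) = of_real (\<alpha> i) * cinner_vec (\<psi> i) (\<psi> i)"
      by (simp add: M_nth[OF i] cinner_vec_def sum_distrib_left mult_ac)
    then have "(\<Sum>a\<in>UNIV. M i $ a $ a) = of_real (\<alpha> i)" using unit[OF i] by (simp add: cinner_vec_self)
    then show "\<alpha> i = (\<Sum>a\<in>UNIV. Re (M i $ a $ a))" by (metis Re_complex_of_real Re_sum)
  qed
  also have "\<dots> = (\<Sum>a\<in>UNIV. Re (?B $ a $ a))"
    by (subst sum.swap) simp
  also have "\<dots> \<le> (\<Sum>a\<in>(UNIV::'d set). op_norm ?B)"
  proof (rule sum_mono)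
    fix a :: 'd
    have "Re (?B $ a $ a) \<le> norm ((?B *v axis a 1) $ a)"
      unfolding matrix_vector_mult_axis_nth by (rule complex_Re_le_cmod)
    also have "\<dots> \<le> norm (?B *v axis a 1)" by (rule Finite_Cartesian_Product.norm_nth_le)
    also have "\<dots> \<le> op_norm ?B * norm (axis a (1::complex))"
      unfolding op_norm_def by (rule onorm[OF bl])
    finally show "Re (?B $ a $ a) \<le> op_norm ?B" by (simp add: norm_axis_1)
  qed
  finally show ?thesis by simp
qed

section \<open>Block determinants and the assignment of indices to blocks\<close>

text \<open>The variable \<open>(i, j)\<close> belongs to putting the index \<open>i\<close> into block \<open>j\<close>.\<close>

definition block_det :: "nat \<Rightarrow> (nat \<times> nat \<Rightarrow> complex) \<Rightarrow> complex" where
  "block_det r z = (\<Prod>j<r. det (mcomb n M (\<lambda>i. z (i, j))))"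

lemma mcomb_cong: "(\<And>i. i < n \<Longrightarrow> z i = z' i) \<Longrightarrow> mcomb n M z = mcomb n M z'"
  by (simp add: mcomb_def)

lemma block_det_upd:
  assumes j: "j < r"
  shows "block_det r (z((i, j) := s)) = det (mcomb n M ((\<lambda>i. z (i, j))(i := s)))
      * (\<Prod>j'\<in>{..<r} - {j}. det (mcomb n M (\<lambda>i. z (i, j'))))"
proof -
  have "(\<lambda>i'. (z((i, j) := s)) (i', j)) = (\<lambda>i. z (i, j))(i := s)" by auto
  moreover have "(\<Prod>j'\<in>{..<r} - {j}. det (mcomb n M (\<lambda>i'. (z((i, j) := s)) (i', j'))))
      = (\<Prod>j'\<in>{..<r} - {j}. det (mcomb n M (\<lambda>i. z (i, j'))))"
    by (intro prod.cong) auto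
  ultimately show ?thesis
    unfolding block_det_def using j by (subst prod.remove[of _ j]) (auto simp only: finite_lessThan lessThan_iff)
qed

lemma block_det_is_mlin: "\<exists>c. \<forall>z. block_det r z = mlin ({..<n} \<times> {..<r}) c z"
proof (rule multiaffine_is_mlin)
  show "finite ({..<n} \<times> {..<r})" by simp
next
  fix z z' :: "nat \<times> nat \<Rightarrow> complex"
  assume "\<And>k. k \<in> {..<n} \<times> {..<r} \<Longrightarrow> z k = z' k"
  then show "block_det r z = block_det r z'"
    unfolding block_det_def by (intro prod.cong arg_cong[where f = det] mcomb_cong) auto
next
  fix z :: "nat \<times> nat \<Rightarrow> complex" and k s assume "k \<in> {..<n} \<times> {..<r}"
  then obtain i j where k: "k = (i, j)" "i < n" "j < r" by auto
  obtain D K where "\<And>s. det (mcomb n M ((\<lambda>i. z (i, j))(i := s))) = D + s * K"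
    using det_mcomb_affine[OF k(2)] by metis
  then show "block_det r (z(k := s)) = block_det r (z(k := 0)) + s * (block_det r (z(k := 1)) - block_det r (z(k := 0)))"
    unfolding k block_det_upd[OF k(3)] by (simp only: ) (simp add: algebra_simps)
next
  fix x :: "nat \<times> nat \<Rightarrow> real"
  show "block_det r (\<lambda>k. of_real (x k)) \<in> \<real>"
    unfolding block_det_def using det_mcomb_real[of "\<lambda>i. x (i, _)"] by (intro prod_in_Reals) auto
qed

text \<open>Nonsingularity for all these \<open>X\<close> says that \<open>r\<close> times each
  block sum has no eigenvalue at or above the bound, in the form that \<open>op_norm_less\<close>
  takes.\<close>

lemma ex_assignment_det_nonzero:
  fixes r :: nat
  assumes r: "r > 0" and C: "C > 0" and bound: "\<And>i. i < n \<Longrightarrow> r * \<alpha> i \<le> C"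
  shows "\<exists>f. (\<forall>i<n. f i < r) \<and> (\<forall>j<r. \<forall>X\<ge>(1 + sqrt C)\<^sup>2.
    det (mcomb n M (\<lambda>i. complex_of_real (if f i = j then X - real r else X))) \<noteq> 0)"
proof -
  define V where "V = {..<n} \<times> {..<r}"
  have fin: "finite V" by (simp add: V_def)
  obtain c where c: "\<And>z. block_det r z = mlin V c z" using block_det_is_mlin unfolding V_def by blast
  have c_real: "of_real (mlin V c x) = block_det r (\<lambda>k. of_real (x k))" for x
    unfolding c mlin_of_real ..
  have st: "stable V c"
    unfolding stable_def
  proof (intro allI impI)
    fix z :: "nat \<times> nat \<Rightarrow> complex" assume z: "\<forall>k\<in>V. Im (z k) > 0"
    have "det (mcomb n M (\<lambda>i. z (i, j))) \<noteq> 0" if "j < r" for j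
      using z that by (intro det_mcomb_nonzero[of "- \<i>"]) (auto simp: V_def)
    then show "mlin V c z \<noteq> 0" unfolding c[symmetric] block_det_def by simp
  qed
  \<comment> \<open>With these values \<open>C / t = 1 - 1 / d\<close>, the bound required of the
    barriers, and \<open>t + d = (1 + sqrt C)\<^sup>2\<close>, the point reached at the end.\<close>
  define t where "t = C + sqrt C"
  define d where "d = 1 + sqrt C"
  have sC: "sqrt C > 0" "sqrt C * sqrt C = C" using C by auto
  have t: "t > 0" and d: "d > 0" using C sC by (simp_all add: t_def d_def add_pos_pos del: real_sqrt_gt_0_iff)
  have zf: "zero_free_above V c (\<lambda>_. t)"
    unfolding zero_free_above_def
  proof (intro allI impI)
    fix x :: "nat \<times> nat \<Rightarrow> real" assume x: "\<forall>k\<in>V. t \<le> x k"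
    have "det (mcomb n M (\<lambda>i. of_real (x (i, j)))) \<noteq> 0" if "j < r" for j
      using x that t by (intro det_mcomb_nonzero[of 1]) (force simp: V_def)
    then have "block_det r (\<lambda>k. of_real (x k)) \<noteq> 0" unfolding block_det_def by simp
    then show "mlin V c x \<noteq> 0" unfolding c_real[symmetric] by simp
  qed
  \<comment> \<open>The factor \<open>r\<close> gives each variable \<open>(i, j)\<close> weight
    \<open>1\<close> in the average \<open>u i\<close>, so the \<open>u i\<close> add up to
    \<open>1\<close> in every coordinate of \<open>V\<close>.\<close>
  define w where "w = (\<lambda>(i::nat) (j::nat) k. if k = (i, j) then real r else 0)"
  define u where "u = (\<lambda>i k. (\<Sum>j<r. w i j k) / r)"
  have w_dd: "mlin V (dd V (w i j) c') x = r * mlin V (pd (i, j) c') x"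
    if "i < n" "j < r" for i j c' and x :: "nat \<times> nat \<Rightarrow> real"
  proof -
    have "mlin V (dd V (w i j) c') x = (\<Sum>k\<in>V. if k = (i, j) then r * mlin V (pd k c') x else 0)"
      unfolding mlin_dd by (intro sum.cong) (auto simp: w_def)
    then show ?thesis using that fin by (simp add: V_def)
  qed
  have bar_w: "barrier V (w i j) c (\<lambda>_. t) = r * \<alpha> i / t" if ij: "i < n" "j < r" for i j
  proof -
    have k: "(i, j) \<in> V" using ij by (simp add: V_def)
    \<comment> \<open>By affinity the derivative is the increment under a unit step, and only the
      factor of block \<open>j\<close> changes.\<close>
    have "of_real (mlin V c ((\<lambda>_. t)((i, j) := t + 1))) = block_det r ((\<lambda>_. complex_of_real t)((i, j) := of_real t + 1))"
      unfolding c_real by (intro arg_cong[where f = "block_det r"]) auto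
    also have "\<dots> = of_real (1 + \<alpha> i / t) * block_det r ((\<lambda>_. of_real t)((i, j) := of_real t))"
      unfolding block_det_upd[OF ij(2)] det_mcomb_step[OF ij(1) t] by (simp only: fun_upd_idem mult.assoc)
    also have "block_det r ((\<lambda>_. of_real t)((i, j) := of_real t)) = of_real (mlin V c (\<lambda>_. t))"
      unfolding c_real by (simp only: fun_upd_idem)
    finally have "mlin V c ((\<lambda>_. t)((i, j) := t + 1)) = (1 + \<alpha> i / t) * mlin V c (\<lambda>_. t)"
      by (simp only: of_real_mult[symmetric] of_real_eq_iff)
    moreover have "mlin V c ((\<lambda>_. t)((i, j) := t + 1)) = mlin V c (\<lambda>_. t) + 1 * mlin V (pd (i, j) c) (\<lambda>_. t)"
      using mlin_upd[OF fin k, of c "\<lambda>_. t" 1] .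
    ultimately have "mlin V (pd (i, j) c) (\<lambda>_. t) = \<alpha> i / t * mlin V c (\<lambda>_. t)"
      by (simp add: algebra_simps)
    moreover have "mlin V c (\<lambda>_. t) \<noteq> 0" using zf by (rule zero_free_aboveD) simp
    ultimately show ?thesis
      unfolding barrier_def w_dd[OF ij] by simp
  qed
  have bar: "barrier V (u i) c (\<lambda>_. t) \<le> 1 - 1 / d" if i: "i < n" for i
  proof -
    have "barrier V (u i) c (\<lambda>_. t) = (\<Sum>j<r. barrier V (w i j) c (\<lambda>_. t)) / card {..<r}"
      using r by (intro barrier_average) (auto simp: u_def)
    also have "\<dots> = r * \<alpha> i / t" using bar_w[OF i] r by simp
    also have "\<dots> \<le> C / t" using bound[OF i] t by (simp add: divide_right_mono)
    also have "\<dots> = 1 - 1 / d"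
    proof -
      have "t = sqrt C * d" using sC by (simp add: t_def d_def algebra_simps)
      then have "C / t = sqrt C / d" using sC by (metis mult_divide_mult_cancel_left less_irrefl)
      then show ?thesis using d by (simp add: d_def field_simps)
    qed
    finally show ?thesis .
  qed
  have "\<exists>f. (\<forall>i<n. f i < r) \<and> zero_free_above V (fold (one_minus_dd V) (map (\<lambda>i. w i (f i)) [0..<n]) c)
           (\<lambda>k. t + d * (\<Sum>i<n. u i k))"
    by (rule zero_free_selection[OF fin st zf d _ r _ bar]) (simp_all add: w_def u_def)
  then obtain f where f: "\<forall>i<n. f i < r"
    and zf': "zero_free_above V (fold (one_minus_dd V) (map (\<lambda>i. w i (f i)) [0..<n]) c)
           (\<lambda>k. t + d * (\<Sum>i<n. u i k))" by blast
  \<comment> \<open>Each operator shifts its variable by \<open>- r\<close>; together they lower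
    exactly the variables \<open>(i, f i)\<close> with \<open>i < m\<close>.\<close>
  have fold: "mlin V (fold (one_minus_dd V) (map (\<lambda>i. w i (f i)) [0..<m]) c) x
      = mlin V c (\<lambda>k. if fst k < m \<and> snd k = f (fst k) then x k - r else x k)"
    if "m \<le> n" for m and x :: "nat \<times> nat \<Rightarrow> real"
    using that
  proof (induction m arbitrary: x)
    case (Suc m)
    let ?c = "fold (one_minus_dd V) (map (\<lambda>i. w i (f i)) [0..<m]) c"
    have m: "m < n" "f m < r" using Suc.prems f by auto
    have "mlin V (one_minus_dd V (w m (f m)) ?c) x = mlin V ?c x - r * mlin V (pd (m, f m) ?c) x"
      using w_dd[OF m] by (simp add: mlin_one_minus_dd)
    also have "\<dots> = mlin V ?c (x((m, f m) := x (m, f m) - r))"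
      using mlin_upd[OF fin, of "(m, f m)" ?c x "- real r"] m by (simp add: V_def)
    also have "\<dots> = mlin V c (\<lambda>k. if fst k < m \<and> snd k = f (fst k)
        then (x((m, f m) := x (m, f m) - r)) k - r else (x((m, f m) := x (m, f m) - r)) k)"
      using Suc by simp
    also have "\<dots> = mlin V c (\<lambda>k. if fst k < Suc m \<and> snd k = f (fst k) then x k - r else x k)"
      by (intro mlin_cong) (auto simp: less_Suc_eq)
    finally show ?case by simp
  qed simp
  have "det (mcomb n M (\<lambda>i. complex_of_real (if f i = j then X - real r else X))) \<noteq> 0"
    if j: "j < r" and X: "X \<ge> (1 + sqrt C)\<^sup>2" for j X
  proof -
    have "\<forall>k\<in>V. t + d * (\<Sum>i<n. u i k) \<le> X"
    proof
      fix k assume "k \<in> V"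
      then obtain i0 j0 where k: "k = (i0, j0)" "i0 < n" "j0 < r" by (auto simp: V_def)
      have "u i k = (if i = i0 then 1 else 0)" for i
        using k r by (simp add: u_def w_def if_distrib cong: if_cong)
      then have "(\<Sum>i<n. u i k) = 1" using k by simp
      moreover have "t + d = (1 + sqrt C)\<^sup>2"
        using sC by (simp add: t_def d_def power2_eq_square algebra_simps)
      ultimately show "t + d * (\<Sum>i<n. u i k) \<le> X" using X by simp
    qed
    from zero_free_aboveD[OF zf' this]
    have "mlin V c (\<lambda>k. if fst k < n \<and> snd k = f (fst k) then X - r else X) \<noteq> 0"
      unfolding fold[OF order_refl] .
    then have "block_det r (\<lambda>k. of_real (if fst k < n \<and> snd k = f (fst k) then X - r else X)) \<noteq> 0"
      unfolding c_real[symmetric] by simp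
    then have "det (mcomb n M (\<lambda>i. of_real (if i < n \<and> j = f i then X - r else X))) \<noteq> 0"
      using j unfolding block_det_def by simp
    moreover have "mcomb n M (\<lambda>i. of_real (if i < n \<and> j = f i then X - r else X))
        = mcomb n M (\<lambda>i. complex_of_real (if f i = j then X - real r else X))"
      by (rule mcomb_cong) auto
    ultimately show ?thesis by simp
  qed
  with f show ?thesis by blast
qed

end

theorem theorem4:
  fixes M :: "nat \<Rightarrow> complex^'d^'d"
    and \<psi> :: "nat \<Rightarrow> complex^'d"
    and \<alpha> :: "nat \<Rightarrow> real"
    and n r :: nat
    and \<epsilon> \<epsilon>' C :: real
  assumes povm: "is_POVM M n"
    and rank1: "\<And>i. i < n \<Longrightarrow> M i = \<alpha> i *\<^sub>R ketbra (\<psi> i)"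
    and unit: "\<And>i. i < n \<Longrightarrow> norm (\<psi> i) = 1"
    and eps_pos: "0 < \<epsilon>'"
    and bounds: "\<And>i. i < n \<Longrightarrow> \<epsilon>' \<le> \<alpha> i \<and> \<alpha> i \<le> \<epsilon>"
    and r: "r \<ge> 1"
    and C_def: "C = real r * \<epsilon>"
  shows "\<exists>S. is_partition S r n
           \<and> q_val M S r \<ge> 1 / (1 + sqrt C)^2
           \<and> (\<forall>\<beta><r. real (card (S \<beta>)) \<le> real CARD('d) * (\<epsilon> / \<epsilon>') * (1 + 1 / sqrt C)^2)"
proof -
  interpret rank_one_povm M \<psi> \<alpha> n
    using povm rank1 unit bounds eps_pos by unfold_locales force+
  \<comment> \<open>The bounds constrain \<open>\<epsilon>\<close> only through an existing index;
    the identity in positive dimension is not an empty sum.\<close>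
  have "n > 0"
  proof (rule ccontr)
    assume "\<not> n > 0"
    then have "mat 1 = (0 :: complex^'d^'d)" using sum_M by simp
    then show False by (simp add: mat_def vec_eq_iff split: if_splits)
  qed
  then have eps: "\<epsilon> > 0" using bounds[of 0] eps_pos by linarith
  then have C: "C > 0" using r by (simp add: C_def)
  have "real r * \<alpha> i \<le> C" if "i < n" for i
    using bounds[OF that] by (simp add: C_def mult_left_mono)
  then obtain f where sel: "\<forall>i<n. f i < r" "\<forall>j<r. \<forall>X\<ge>(1 + sqrt C)\<^sup>2.
      det (mcomb n M (\<lambda>i. complex_of_real (if f i = j then X - real r else X))) \<noteq> 0"
    using ex_assignment_det_nonzero[of r C] r C by fastforce
  note f = sel(1)[rule_format] and det = sel(2)[rule_format]
  define S where "S = (\<lambda>j. {i. i < n \<and> f i = j})"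
  define l where "l = (1 + sqrt C)\<^sup>2"
  have S: "S j \<subseteq> {..<n}" for j by (auto simp: S_def)
  have part: "is_partition S r n"
    using f by (auto simp: is_partition_def S_def)
  have norm: "r * op_norm (\<Sum>i\<in>S j. M i) < l" if j: "j < r" for j
  proof (rule op_norm_less[OF S])
    fix X assume "X \<ge> l"
    moreover have "mcomb n M (\<lambda>i. complex_of_real (if f i = j then X - real r else X))
        = mcomb n M (\<lambda>i. of_real (if i \<in> S j then X - r else X))"
      by (rule mcomb_cong) (simp add: S_def)
    ultimately show "det (mcomb n M (\<lambda>i. of_real (if i \<in> S j then X - r else X))) \<noteq> 0"
      using det[OF j, of X] by (simp add: l_def)
  qed
  \<comment> \<open>As \<open>inverse 0 = 0\<close>, the upper bound on the sum yields a lower bound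
    on \<open>q_val\<close> only once the sum is known to be positive.\<close>
  have sum_pos: "(\<Sum>j<r. op_norm (\<Sum>i\<in>S j. M i)) > 0"
  proof -
    have "0 < (\<Sum>i<n. \<alpha> i)" using pos \<open>n > 0\<close> by (intro sum_pos) auto
    also have "\<dots> = (\<Sum>j<r. \<Sum>i\<in>S j. \<alpha> i)"
      using f unfolding S_def by (subst sum.group[symmetric, of "{..<n}" "{..<r}" f]) auto
    also have "\<dots> \<le> (\<Sum>j<r. CARD('d) * op_norm (\<Sum>i\<in>S j. M i))"
      using S by (intro sum_mono sum_weights_le)
    finally show ?thesis by (simp add: sum_distrib_left[symmetric] zero_less_mult_iff)
  qed
  have "(\<Sum>j<r. op_norm (\<Sum>i\<in>S j. M i)) \<le> (\<Sum>j<r. l / r)"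
    using norm r by (intro sum_mono) (simp add: field_simps less_imp_le)
  then have "(\<Sum>j<r. op_norm (\<Sum>i\<in>S j. M i)) \<le> l" using r by simp
  then have q: "q_val M S r \<ge> 1 / l"
    using sum_pos by (simp add: q_val_def le_imp_inverse_le inverse_eq_divide[symmetric])
  have "real (card (S j)) \<le> real CARD('d) * (\<epsilon> / \<epsilon>') * (1 + 1 / sqrt C)^2" if j: "j < r" for j
  proof -
    have "card (S j) * \<epsilon>' = (\<Sum>i\<in>S j. \<epsilon>')" by simp
    also have "\<dots> \<le> (\<Sum>i\<in>S j. \<alpha> i)" using bounds S by (intro sum_mono) auto
    also have "\<dots> \<le> CARD('d) * op_norm (\<Sum>i\<in>S j. M i)" by (rule sum_weights_le[OF S])
    also have "\<dots> \<le> CARD('d) * (l / r)"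
      using norm[OF j] r by (intro mult_left_mono) (simp_all add: field_simps)
    \<comment> \<open>Factoring \<open>sqrt C\<close> out of \<open>1 + sqrt C\<close> leaves
      \<open>C / r = \<epsilon>\<close> in front.\<close>
    also have "l / r = \<epsilon> * (1 + 1 / sqrt C)\<^sup>2"
    proof -
      have "1 + sqrt C = sqrt C * (1 + 1 / sqrt C)" using C by (simp add: field_simps)
      then have "l = C * (1 + 1 / sqrt C)\<^sup>2" using C by (simp add: l_def power_mult_distrib)
      then show ?thesis using r by (simp add: C_def)
    qed
    finally show ?thesis using eps_pos by (simp add: field_simps)
  qed
  with part q show ?thesis unfolding l_def by blast
qed

end
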